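(* Let $F$ be a projectively flat Finsler metric with projective factor $P$, so that $G^i=P(x,y)\,y^i$ and $H_i=P(x,y)\,y_i$, where $y_i:=g_{ij}y^j$. Then $$H^i_{jk}=G^i_{jk}+2P\,C^i_{jk},$$ where $G^i_{jk}=P_{jk}\,y^i+P_j\,\delta^i_k+P_k\,\delta^i_j$, and in this case the functions $H^i_{jk}$ are the coefficients of a linear connection.
   Context: $M$ is an $n$-dimensional smooth manifold, $TM$ its tangent bundle, $\mathcal{T}M=TM\setminus\{0\}$ the slit tangent bundle. $(x^i)$ are local coordinates on $M$ and $(x^i,y^i)$ the induced coordinates on $TM$; $\partial_i:=\frac{\partial}{\partial x^i}$, $\dot{\partial}_i:=\frac{\partial}{\partial y^i}$; the summation convention is used. A Finsler metric is a function $F:TM\to\mathbb{R}$ with $F\ge 0$, $F(x,y)=0$ iff $y=0$, $F$ smooth on $\mathcal{T}M$, $F(x,\lambda y)=\lambda F(x,y)$ for $\lambda>0$, and such that the matrix $g_{ij}:=\frac12\dot{\partial}_i\dot{\partial}_jF^2$ is non-degenerate at each point of $\mathcal{T}M$; $(g^{ij})$ is its inverse. The geodesic spray of $F$ is $S=y^i\partial_i-2G^i\dot{\partial}_i$ with $G^i=\frac14 g^{ih}(y^r\partial_r\dot{\partial}_hF^2-\partial_hF^2)$; the Berwald connection coefficients are $G^i_{jk}:=\dot{\partial}_k\dot{\partial}_jG^i$. $C_{ijk}:=\frac12\dot{\partial}_kg_{ij}$ is the Cartan tensor and $C^i_{jk}:=g^{ir}C_{rjk}$. The $F$-covariant coefficients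 of $S$ are $H_i:=g_{ir}G^r$; put $H_{ijk}:=\dot{\partial}_k\dot{\partial}_jH_i$ and $H^i_{jk}:=g^{ri}H_{rjk}$. $F$ is projectively flat if $y^k\dot{\partial}_i\partial_kF-\partial_iF=0$; in this case $G^i=P\,y^i$ with projective factor $P=\frac{y^i\partial_iF}{2F}$. Notation: $P_j:=\dot{\partial}_jP$, $P_{jk}:=\dot{\partial}_kP_j$. "Linear connection" is meant in the usual Finsler-geometric sense, in which the coefficients may depend on $(x,y)\in\mathcal{T}M$. *)

theory Defs
  imports "HOL-Analysis.Analysis"
begin

section \<open>Smooth maps and smooth manifolds\<close>

primrec Ck_on ::
  "nat \<Rightarrow> ('a::real_normed_vector \<Rightarrow> 'b::real_normed_vector) \<Rightarrow> 'a set \<Rightarrow> bool" where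
  "Ck_on 0 f S \<longleftrightarrow> continuous_on S f"
| "Ck_on (Suc k) f S \<longleftrightarrow> (\<forall>x\<in>S. f differentiable (at x)) \<and>
     (\<forall>v. Ck_on k (\<lambda>x. frechet_derivative f (at x) v) S)"

text \<open>Meant for open subsets \<open>S\<close> of a finite-dimensional space.\<close>

definition smooth_on ::
  "('a::real_normed_vector \<Rightarrow> 'b::real_normed_vector) \<Rightarrow> 'a set \<Rightarrow> bool" where
  "smooth_on f S \<longleftrightarrow> (\<forall>k. Ck_on k f S)"

text \<open>The manifold is the whole type \<open>'m\<close>; its dimension is \<open>CARD('n)\<close>. A chart is a pair of a
  domain and a coordinate map, whose values outside the domain are irrelevant.\<close>

type_synonym ('m, 'n) chart = "'m set \<times> ('m \<Rightarrow> real ^ 'n)"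

definition chart_inv :: "('m, 'n) chart \<Rightarrow> real ^ 'n \<Rightarrow> 'm" where
  "chart_inv c = inv_into (fst c) (snd c)"

definition is_chart :: "('m::topological_space, 'n::finite) chart \<Rightarrow> bool" where
  "is_chart c \<longleftrightarrow> open (fst c) \<and> open (snd c ` fst c) \<and>
     homeomorphism (fst c) (snd c ` fst c) (snd c) (chart_inv c)"

definition transition :: "('m, 'n) chart \<Rightarrow> ('m, 'n) chart \<Rightarrow> real ^ 'n \<Rightarrow> real ^ 'n" where
  "transition c d = snd d \<circ> chart_inv c"

definition compatible :: "('m, 'n::finite) chart \<Rightarrow> ('m, 'n) chart \<Rightarrow> bool" where
  "compatible c d \<longleftrightarrow> smooth_on (transition c d) (snd c ` (fst c \<inter> fst d)) \<and>
     smooth_on (transition d c) (snd d ` (fst c \<inter> fst d))"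

definition maximal_smooth_atlas :: "('m::topological_space, 'n::finite) chart set \<Rightarrow> bool" where
  "maximal_smooth_atlas A \<longleftrightarrow> (\<forall>c\<in>A. is_chart c) \<and> (\<Union>c\<in>A. fst c) = UNIV \<and>
     (\<forall>c\<in>A. \<forall>d\<in>A. compatible c d) \<and>
     (\<forall>c. is_chart c \<and> (\<forall>d\<in>A. compatible c d) \<longrightarrow> c \<in> A)"


section \<open>The tangent bundle\<close>

text \<open>A tangent vector at \<open>p\<close> is the family of its component vectors with respect to all charts
  around \<open>p\<close>, related by the Jacobians of the coordinate changes (and \<open>0\<close> at charts that do not
  contain \<open>p\<close>, so that the family is unique). Addition, scaling and zero are pointwise.\<close>

type_synonym ('m, 'n) tvec = "'m \<times> (('m, 'n) chart \<Rightarrow> real ^ 'n)"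

definition tangent_bundle :: "('m, 'n::finite) chart set \<Rightarrow> 'm set \<Rightarrow> ('m, 'n) tvec set" where
  "tangent_bundle A U = {(p, \<xi>). p \<in> U \<and>
     (\<forall>c. \<not> (c \<in> A \<and> p \<in> fst c) \<longrightarrow> \<xi> c = 0) \<and>
     (\<forall>c\<in>A. \<forall>d\<in>A. p \<in> fst c \<inter> fst d \<longrightarrow>
        \<xi> d = frechet_derivative (transition c d) (at (snd c p)) (\<xi> c))}"

definition slit_tangent_bundle :: "('m, 'n::finite) chart set \<Rightarrow> 'm set \<Rightarrow> ('m, 'n) tvec set" where
  "slit_tangent_bundle A U = {(p, \<xi>) \<in> tangent_bundle A U. \<xi> \<noteq> (\<lambda>_. 0)}"

text \<open>The tangent vector \<open>y\<^sup>i \<partial>/\<partial>x\<^sup>i\<close> at the point with coordinates \<open>x\<close> in the chart \<open>c\<close>.\<close>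

definition tangent_vector ::
  "('m, 'n::finite) chart set \<Rightarrow> ('m, 'n) chart \<Rightarrow> (real ^ 'n) \<times> (real ^ 'n) \<Rightarrow> ('m, 'n) tvec" where
  "tangent_vector A c = (\<lambda>(x, y). (chart_inv c x,
     \<lambda>d. if d \<in> A \<and> chart_inv c x \<in> fst d
         then frechet_derivative (transition c d) (at x) y else 0))"

definition local_rep ::
  "('m, 'n::finite) chart set \<Rightarrow> ('m, 'n) chart \<Rightarrow> (('m, 'n) tvec \<Rightarrow> real)
    \<Rightarrow> (real ^ 'n) \<times> (real ^ 'n) \<Rightarrow> real" where
  "local_rep A c f = (\<lambda>q. f (tangent_vector A c q))"

definition slit_dom :: "('m, 'n) chart \<Rightarrow> ((real ^ 'n) \<times> (real ^ 'n)) set" where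
  "slit_dom c = {(x, y). x \<in> snd c ` fst c \<and> y \<noteq> 0}"


section \<open>Finsler geometry in induced coordinates\<close>

text \<open>The functions of this section take the coordinate expression \<open>f\<close> of a Finsler metric \<open>F\<close>,
  a function of \<open>(x, y)\<close>.\<close>

definition dx :: "'n::finite \<Rightarrow> ((real ^ 'n) \<times> (real ^ 'n) \<Rightarrow> real) \<Rightarrow> (real ^ 'n) \<times> (real ^ 'n) \<Rightarrow> real"
  where "dx i f q = frechet_derivative f (at q) (axis i 1, 0)"

definition dy :: "'n::finite \<Rightarrow> ((real ^ 'n) \<times> (real ^ 'n) \<Rightarrow> real) \<Rightarrow> (real ^ 'n) \<times> (real ^ 'n) \<Rightarrow> real"
  where "dy i f q = frechet_derivative f (at q) (0, axis i 1)"

context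
  fixes f :: "(real ^ 'n::finite) \<times> (real ^ 'n) \<Rightarrow> real"
begin

definition metric :: "(real ^ 'n) \<times> (real ^ 'n) \<Rightarrow> real ^ 'n ^ 'n" where
  "metric q = (\<chi> i j. 1/2 * dy i (dy j (\<lambda>q. (f q)\<^sup>2)) q)"

definition metric_inv :: "(real ^ 'n) \<times> (real ^ 'n) \<Rightarrow> real ^ 'n ^ 'n" where
  "metric_inv q = matrix_inv (metric q)"

definition y_low :: "'n \<Rightarrow> (real ^ 'n) \<times> (real ^ 'n) \<Rightarrow> real" where
  "y_low i q = (\<Sum>j\<in>UNIV. metric q $ i $ j * snd q $ j)"

definition spray :: "'n \<Rightarrow> (real ^ 'n) \<times> (real ^ 'n) \<Rightarrow> real" where
  "spray i q = 1/4 * (\<Sum>h\<in>UNIV. metric_inv q $ i $ h *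
     ((\<Sum>r\<in>UNIV. snd q $ r * dx r (dy h (\<lambda>q. (f q)\<^sup>2)) q) - dx h (\<lambda>q. (f q)\<^sup>2) q))"

definition berwald :: "'n \<Rightarrow> 'n \<Rightarrow> 'n \<Rightarrow> (real ^ 'n) \<times> (real ^ 'n) \<Rightarrow> real" where
  "berwald i j k = dy k (dy j (spray i))"

definition cartan :: "'n \<Rightarrow> 'n \<Rightarrow> 'n \<Rightarrow> (real ^ 'n) \<times> (real ^ 'n) \<Rightarrow> real" where
  "cartan i j k q = 1/2 * dy k (\<lambda>q. metric q $ i $ j) q"

definition cartan_up :: "'n \<Rightarrow> 'n \<Rightarrow> 'n \<Rightarrow> (real ^ 'n) \<times> (real ^ 'n) \<Rightarrow> real" where
  "cartan_up i j k q = (\<Sum>r\<in>UNIV. metric_inv q $ i $ r * cartan r j k q)"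

definition H_low :: "'n \<Rightarrow> (real ^ 'n) \<times> (real ^ 'n) \<Rightarrow> real" where
  "H_low i q = (\<Sum>r\<in>UNIV. metric q $ i $ r * spray r q)"

definition H_low3 :: "'n \<Rightarrow> 'n \<Rightarrow> 'n \<Rightarrow> (real ^ 'n) \<times> (real ^ 'n) \<Rightarrow> real" where
  "H_low3 i j k = dy k (dy j (H_low i))"

definition H_coeff :: "'n \<Rightarrow> 'n \<Rightarrow> 'n \<Rightarrow> (real ^ 'n) \<times> (real ^ 'n) \<Rightarrow> real" where
  "H_coeff i j k q = (\<Sum>r\<in>UNIV. metric_inv q $ r $ i * H_low3 r j k q)"

end


section \<open>Finsler metrics, projective flatness, linear connections\<close>

definition finsler_metric :: "('m, 'n::finite) chart set \<Rightarrow> (('m, 'n) tvec \<Rightarrow> real) \<Rightarrow> bool" where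
  "finsler_metric A F \<longleftrightarrow>
     (\<forall>v \<in> tangent_bundle A UNIV. F v \<ge> 0 \<and> (F v = 0 \<longleftrightarrow> snd v = (\<lambda>_. 0))) \<and>
     (\<forall>(p, \<xi>) \<in> tangent_bundle A UNIV. \<forall>l>0. F (p, \<lambda>c. l *\<^sub>R \<xi> c) = l * F (p, \<xi>)) \<and>
     (\<forall>c\<in>A. smooth_on (local_rep A c F) (slit_dom c)) \<and>
     (\<forall>c\<in>A. \<forall>q \<in> slit_dom c. invertible (metric (local_rep A c F) q))"

text \<open>The equation defining projective flatness is not invariant under changes of coordinates, and
  neither is the expression for the projective factor; both refer to the given coordinates \<open>c\<close>.
  The factor itself is a scalar function on the slit tangent bundle over the domain of \<open>c\<close>.\<close>

definition projectively_flat ::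
  "('m, 'n::finite) chart set \<Rightarrow> (('m, 'n) tvec \<Rightarrow> real) \<Rightarrow> ('m, 'n) chart \<Rightarrow> bool" where
  "projectively_flat A F c \<longleftrightarrow> (let f = local_rep A c F in
     \<forall>q \<in> slit_dom c. \<forall>i. (\<Sum>k\<in>UNIV. snd q $ k * dy i (dx k f) q) - dx i f q = 0)"

definition projective_factor ::
  "('m, 'n::finite) chart set \<Rightarrow> (('m, 'n) tvec \<Rightarrow> real) \<Rightarrow> ('m, 'n) chart
    \<Rightarrow> ('m, 'n) tvec \<Rightarrow> real" where
  "projective_factor A F c = (\<lambda>(p, \<xi>). let f = local_rep A c F; q = (snd c p, \<xi> c) in
     (\<Sum>i\<in>UNIV. snd q $ i * dx i f q) / (2 * f q))"

text \<open>A linear connection over the open set \<open>U\<close>, with coefficients depending on \<open>(x, y)\<close>, is given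
  by coefficients \<open>\<Gamma> c i j k\<close> (upper index \<open>i\<close>) in each chart \<open>c\<close> inside \<open>U\<close>, which obey, with
  \<open>t\<close> the coordinate change from \<open>x\<close> to \<open>x'\<close>, the classical law
  \[ \frac{\partial x'^i}{\partial x^l} \Gamma^l_{jk}(x, y) =
     \Gamma'^i_{mn}(x', y') \frac{\partial x'^m}{\partial x^j} \frac{\partial x'^n}{\partial x^k}
     + \frac{\partial^2 x'^i}{\partial x^j \partial x^k}. \]\<close>

definition linear_connection_on ::
  "('m, 'n::finite) chart set \<Rightarrow> 'm set
    \<Rightarrow> (('m, 'n) chart \<Rightarrow> 'n \<Rightarrow> 'n \<Rightarrow> 'n \<Rightarrow> (real ^ 'n) \<times> (real ^ 'n) \<Rightarrow> real) \<Rightarrow> bool" where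
  "linear_connection_on A U \<Gamma> \<longleftrightarrow>
     (\<forall>c\<in>A. fst c \<subseteq> U \<longrightarrow> (\<forall>i j k. smooth_on (\<Gamma> c i j k) (slit_dom c))) \<and>
     (\<forall>c\<in>A. \<forall>d\<in>A. fst c \<subseteq> U \<and> fst d \<subseteq> U \<longrightarrow>
       (\<forall>x \<in> snd c ` (fst c \<inter> fst d). \<forall>y. y \<noteq> 0 \<longrightarrow> (\<forall>i j k.
         let t = transition c d;
             y' = frechet_derivative t (at x) y;
             J = (\<lambda>i j x. frechet_derivative t (at x) (axis j 1) $ i)
         in (\<Sum>l\<in>UNIV. J i l x * \<Gamma> c l j k (x, y)) =
            (\<Sum>m\<in>UNIV. \<Sum>n\<in>UNIV. \<Gamma> d i m n (t x, y') * J m j x * J n k x)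
            + frechet_derivative (J i k) (at x) (axis j 1))))"

end

theory Submission
  imports Defs
begin

text \<open>Write \<open>L = F\<^sup>2\<close>. Homogeneity of \<open>F\<close> gives, by Euler's relation, \<open>y\<^sub>i = (1/2) \<partial>L/\<partial>y\<^sup>i\<close>, so
  that differentiating \<open>y\<^sub>i\<close> along the fibre reproduces the metric and differentiating the metric
  gives twice the Cartan tensor. Projective flatness turns the covector \<open>4 g\<^sub>h\<^sub>i G\<^sup>i\<close> of the
  geodesic spray into \<open>4 P y\<^sub>h\<close> (lemma \<open>spray_covector_flat\<close>), whence \<open>G\<^sup>i = P y\<^sup>i\<close> and \<open>H\<^sub>i = P
  y\<^sub>i\<close>. Two fibre derivatives of \<open>P y\<^sub>r\<close> then yield \<open>P\<^sub>j\<^sub>k y\<^sub>r + P\<^sub>j g\<^sub>r\<^sub>k + P\<^sub>k g\<^sub>r\<^sub>j + 2 P C\<^sub>r\<^sub>j\<^sub>k\<close>, and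
  raising \<open>r\<close> turns the first three terms into the Berwald coefficients of \<open>P y\<^sup>i\<close> (lemma
  \<open>H_coeff_flat\<close>).

  The right-hand side \<open>G\<^sup>i\<^sub>j\<^sub>k + 2 P C\<^sup>i\<^sub>j\<^sub>k\<close> makes sense in every chart once \<open>P\<close> is regarded as a
  scalar function on the slit tangent bundle, and it is this expression that serves as the
  linear connection. Under a coordinate change with Jacobian \<open>J\<close> the spray coefficients acquire
  the inhomogeneous term \<open>(1/2) J\<^sup>n\<^sub>r\<^sub>s y\<^sup>r y\<^sup>s\<close> (lemma \<open>spray_change\<close>), where \<open>J\<^sup>n\<^sub>r\<^sub>s\<close> are the second
  derivatives of the coordinate change. Two fibre derivatives leave exactly the term \<open>J\<^sup>n\<^sub>j\<^sub>k\<close> that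
  the classical law of a connection demands (lemma \<open>berwald_change\<close>). The Cartan tensor
  transforms as a tensor because the Jacobian is constant along the fibres (lemma
  \<open>cartan_up_change\<close>), so a scalar multiple of it may be added to any connection without
  disturbing the law.

  The coefficients \<open>H\<^sup>i\<^sub>j\<^sub>k\<close> themselves are computed from \<open>F\<close> in a chart, and the computation of the
  first part identifies them with this connection in every chart in which \<open>F\<close> satisfies the
  flatness equation with the same factor \<open>P\<close>.\<close>

section \<open>Calculus of smooth maps\<close>

lemma frechet_derivativeI:
  "(f has_derivative f') (at x) \<Longrightarrow> frechet_derivative f (at x) v = f' v"
  by (metis frechet_derivative_at)

lemma Ck_on_cong:
  assumes "open S"
  shows "(\<And>x. x \<in> S \<Longrightarrow> f x = g x) \<Longrightarrow> Ck_on k f S \<Longrightarrow> Ck_on k g S"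
proof (induction k arbitrary: f g)
  case 0
  then show ?case by (simp cong: continuous_on_cong)
next
  case (Suc k)
  have d: "g differentiable (at x)" if "x \<in> S" for x
    using Suc.prems that assms has_derivative_transform_within_open[of f _ x UNIV S g]
    by (simp add: differentiable_def) blast
  have e: "frechet_derivative f (at x) v = frechet_derivative g (at x) v" if "x \<in> S" for x v
    using Suc.prems that assms frechet_derivative_transform_within_open[of f x S g] by auto
  show ?case
    using Suc.prems d Suc.IH[of "\<lambda>x. frechet_derivative f (at x) v"
        "\<lambda>x. frechet_derivative g (at x) v" for v] e by auto
qed

lemma Ck_on_lower: "Ck_on (Suc k) f S \<Longrightarrow> Ck_on k f S"
proof (induction k arbitrary: f)
  case 0
  then show ?case
    by (auto intro!: continuous_at_imp_continuous_on differentiable_imp_continuous_within)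
next
  case (Suc k)
  then show ?case by auto
qed

text \<open>The induction step shared by all closure properties: it suffices to know some expression
  for the derivative and its regularity one order lower.\<close>

lemma Ck_on_SucI:
  assumes "open S" "\<And>x. x \<in> S \<Longrightarrow> (f has_derivative (\<lambda>v. f' v x)) (at x)"
    and "\<And>v. Ck_on k (f' v) S"
  shows "Ck_on (Suc k) f S"
proof -
  have "Ck_on k (\<lambda>x. frechet_derivative f (at x) v) S" for v
    by (rule Ck_on_cong[OF assms(1) _ assms(3)[of v]])
      (simp add: frechet_derivativeI[OF assms(2)])
  then show ?thesis using assms(2) by (auto simp: differentiable_def)
qed

lemma Ck_on_SucD:
  assumes "Ck_on (Suc k) f S" "x \<in> S"
  shows "(f has_derivative (\<lambda>v. frechet_derivative f (at x) v)) (at x)"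
  using assms by (auto simp: frechet_derivative_works)

lemma Ck_on_const: "open S \<Longrightarrow> Ck_on k (\<lambda>x. c) S"
  by (induction k arbitrary: c) (auto simp: continuous_on_const)

lemma Ck_on_ident: "open S \<Longrightarrow> Ck_on k (\<lambda>x. x) S"
  by (cases k) (auto simp: Ck_on_const)

lemma Ck_on_bounded_linear:
  assumes "open S" "bounded_linear h"
  shows "Ck_on k f S \<Longrightarrow> Ck_on k (\<lambda>x. h (f x)) S"
proof (induction k arbitrary: f)
  case 0
  then show ?case using bounded_linear.continuous_on[OF assms(2)] by simp
next
  case (Suc k)
  show ?case
    by (rule Ck_on_SucI[OF assms(1) bounded_linear.has_derivative[OF assms(2) Ck_on_SucD[OF Suc.prems]]])
      (use Suc in auto)
qed

lemma Ck_on_add: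
  assumes "open S"
  shows "Ck_on k f S \<Longrightarrow> Ck_on k g S \<Longrightarrow> Ck_on k (\<lambda>x. f x + g x) S"
proof (induction k arbitrary: f g)
  case 0
  then show ?case by (auto intro: continuous_on_add)
next
  case (Suc k)
  show ?case
    by (rule Ck_on_SucI[OF assms(1) has_derivative_add[OF Ck_on_SucD[OF Suc.prems(1)] Ck_on_SucD[OF Suc.prems(2)]]])
      (use Suc in auto)
qed

lemma Ck_on_sum:
  assumes "open S"
  shows "(\<And>i. i \<in> I \<Longrightarrow> Ck_on k (f i) S) \<Longrightarrow> Ck_on k (\<lambda>x. \<Sum>i\<in>I. f i x) S"
  by (induction I rule: infinite_finite_induct) (auto simp: Ck_on_const Ck_on_add assms)

lemma Ck_on_bilinear:
  assumes "open S" "bounded_bilinear b"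
  shows "Ck_on k f S \<Longrightarrow> Ck_on k g S \<Longrightarrow> Ck_on k (\<lambda>x. b (f x) (g x)) S"
proof (induction k arbitrary: f g)
  case 0
  then show ?case using bounded_bilinear.continuous_on[OF assms(2)] by auto
next
  case (Suc k)
  have "Ck_on k (\<lambda>x. b (f x) (frechet_derivative g (at x) v)
        + b (frechet_derivative f (at x) v) (g x)) S" for v
    using Suc Ck_on_lower[of k f S] Ck_on_lower[of k g S] by (intro Ck_on_add assms(1)) auto
  then show ?case
    using Ck_on_SucI[OF assms(1), of "\<lambda>x. b (f x) (g x)" "\<lambda>v x. b (f x) (frechet_derivative g (at x) v)
        + b (frechet_derivative f (at x) v) (g x)"]
      bounded_bilinear.FDERIV[OF assms(2) Ck_on_SucD[OF Suc.prems(1)] Ck_on_SucD[OF Suc.prems(2)]]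
    by blast
qed

lemma Ck_on_inverse:
  fixes f :: "'a::real_normed_vector \<Rightarrow> real"
  assumes "open S" "\<And>x. x \<in> S \<Longrightarrow> f x \<noteq> 0"
  shows "Ck_on k f S \<Longrightarrow> Ck_on k (\<lambda>x. inverse (f x)) S"
proof (induction k)
  case 0
  then show ?case using assms by (auto intro!: continuous_on_inverse)
next
  case (Suc k)
  have i: "Ck_on k (\<lambda>x. inverse (f x)) S" using Suc Ck_on_lower by blast
  have d: "Ck_on k (\<lambda>x. frechet_derivative f (at x) v) S" for v using Suc.prems by auto
  have "Ck_on k (\<lambda>x. - (inverse (f x) * frechet_derivative f (at x) v * inverse (f x))) S" for v
    by (intro Ck_on_bounded_linear[OF assms(1) bounded_linear_minus[OF bounded_linear_ident]]
        Ck_on_bilinear[OF assms(1) bounded_bilinear_mult] i d)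
  then show ?case
    using Ck_on_SucI[OF assms(1), of "\<lambda>x. inverse (f x)" "\<lambda>v x.
        - (inverse (f x) * frechet_derivative f (at x) v * inverse (f x))"]
      Deriv.has_derivative_inverse[OF assms(2) Ck_on_SucD[OF Suc.prems(1)]]
    by blast
qed

text \<open>The derivative of a composition applies the derivative of the outer map to a direction
  that varies with the point. Expanding that direction in an orthonormal basis leaves only
  derivatives of the outer map in fixed directions, which are the ones that \<^const>\<open>Ck_on\<close>
  controls; this is why the intermediate space is Euclidean.\<close>

lemma Ck_on_compose:
  fixes g :: "'a::real_normed_vector \<Rightarrow> 'b::euclidean_space"
  assumes "open S" "g ` S \<subseteq> T"
  shows "Ck_on k f T \<Longrightarrow> Ck_on k g S \<Longrightarrow> Ck_on k (\<lambda>x. f (g x)) S"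
proof (induction k arbitrary: f)
  case 0
  then show ?case using assms continuous_on_compose2 by auto
next
  case (Suc k)
  have gT: "g x \<in> T" if "x \<in> S" for x using that assms by auto
  have c: "((\<lambda>x. f (g x)) has_derivative
      (\<lambda>v. \<Sum>b\<in>Basis. (frechet_derivative g (at x) v \<bullet> b) *\<^sub>R frechet_derivative f (at (g x)) b)) (at x)"
    if x: "x \<in> S" for x
  proof -
    have "((\<lambda>x. f (g x)) has_derivative
      (\<lambda>v. frechet_derivative f (at (g x)) (frechet_derivative g (at x) v))) (at x)"
      using has_derivative_compose[OF Ck_on_SucD[OF Suc.prems(2) x] Ck_on_SucD[OF Suc.prems(1) gT[OF x]]] .
    moreover have "linear (frechet_derivative f (at (g x)))"
      using Suc.prems(1) gT[OF x] by (auto intro: linear_frechet_derivative)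
    then have *: "frechet_derivative f (at (g x)) (\<Sum>b\<in>Basis. (w \<bullet> b) *\<^sub>R b)
        = (\<Sum>b\<in>Basis. (w \<bullet> b) *\<^sub>R frechet_derivative f (at (g x)) b)" for w
      by (simp only: linear_sum linear_scale)
    ultimately show ?thesis
      by (elim has_derivative_eq_rhs) (intro ext *[unfolded euclidean_representation])
  qed
  have g: "Ck_on k g S" using Suc.prems Ck_on_lower by blast
  have "Ck_on k (\<lambda>x. \<Sum>b\<in>Basis. (frechet_derivative g (at x) v \<bullet> b) *\<^sub>R frechet_derivative f (at (g x)) b) S" for v
    using Suc.prems
    by (intro Ck_on_sum assms(1) Ck_on_bilinear[OF assms(1) bounded_bilinear_scaleR]
        Ck_on_bounded_linear[OF assms(1) bounded_linear_inner_left] Suc.IH g) auto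
  with Ck_on_SucI[OF assms(1) c] show ?case by blast
qed

lemma smooth_on_cong:
  "smooth_on f S \<Longrightarrow> open S \<Longrightarrow> (\<And>x. x \<in> S \<Longrightarrow> f x = g x) \<Longrightarrow> smooth_on g S"
  unfolding smooth_on_def by (metis Ck_on_cong)

lemma Ck_on_subset: "Ck_on k f S \<Longrightarrow> T \<subseteq> S \<Longrightarrow> Ck_on k f T"
  by (induction k arbitrary: f) (auto intro: continuous_on_subset)

lemma smooth_on_subset: "smooth_on f S \<Longrightarrow> T \<subseteq> S \<Longrightarrow> smooth_on f T"
  unfolding smooth_on_def by (metis Ck_on_subset)

lemma smooth_on_has_derivative:
  "smooth_on f S \<Longrightarrow> x \<in> S \<Longrightarrow> (f has_derivative frechet_derivative f (at x)) (at x)"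
  unfolding smooth_on_def using Ck_on_SucD by blast

lemma smooth_on_differentiable: "smooth_on f S \<Longrightarrow> x \<in> S \<Longrightarrow> f differentiable (at x)"
  using smooth_on_has_derivative by (auto simp: differentiable_def)

lemma smooth_on_frechet_derivative:
  "smooth_on f S \<Longrightarrow> smooth_on (\<lambda>x. frechet_derivative f (at x) v) S"
  unfolding smooth_on_def by (metis Ck_on.simps(2))

lemma smooth_on_imp_continuous_on: "smooth_on f S \<Longrightarrow> continuous_on S f"
  unfolding smooth_on_def using Ck_on.simps(1) by blast

lemma smooth_on_const: "open S \<Longrightarrow> smooth_on (\<lambda>x. c) S"
  by (simp add: smooth_on_def Ck_on_const)

lemma smooth_on_bounded_linear:
  "smooth_on f S \<Longrightarrow> bounded_linear h \<Longrightarrow> open S \<Longrightarrow> smooth_on (\<lambda>x. h (f x)) S"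
  by (simp add: smooth_on_def Ck_on_bounded_linear)

lemma smooth_on_linear: "bounded_linear h \<Longrightarrow> open S \<Longrightarrow> smooth_on h S"
  using smooth_on_bounded_linear[of "\<lambda>x. x" S h] unfolding smooth_on_def by (metis Ck_on_ident)

lemma smooth_on_add:
  "smooth_on f S \<Longrightarrow> smooth_on g S \<Longrightarrow> open S \<Longrightarrow> smooth_on (\<lambda>x. f x + g x) S"
  by (simp add: smooth_on_def Ck_on_add)

lemma smooth_on_sum:
  "(\<And>i. i \<in> I \<Longrightarrow> smooth_on (f i) S) \<Longrightarrow> open S \<Longrightarrow> smooth_on (\<lambda>x. \<Sum>i\<in>I. f i x) S"
  by (simp add: smooth_on_def Ck_on_sum)

lemma smooth_on_scaleR:
  "smooth_on f S \<Longrightarrow> smooth_on g S \<Longrightarrow> open S \<Longrightarrow> smooth_on (\<lambda>x. f x *\<^sub>R g x) S"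
  by (simp add: smooth_on_def Ck_on_bilinear[OF _ bounded_bilinear_scaleR])

lemma smooth_on_mult:
  fixes f g :: "'a::real_normed_vector \<Rightarrow> real"
  shows "smooth_on f S \<Longrightarrow> smooth_on g S \<Longrightarrow> open S \<Longrightarrow> smooth_on (\<lambda>x. f x * g x) S"
  by (simp add: smooth_on_def Ck_on_bilinear[OF _ bounded_bilinear_mult])

lemma smooth_on_diff:
  fixes f g :: "'a::real_normed_vector \<Rightarrow> real"
  shows "smooth_on f S \<Longrightarrow> smooth_on g S \<Longrightarrow> open S \<Longrightarrow> smooth_on (\<lambda>x. f x - g x) S"
  using smooth_on_add[of f S "\<lambda>x. - 1 * g x"] smooth_on_mult[OF smooth_on_const, of S g "-1"] by simp

lemma smooth_on_power2:
  fixes f :: "'a::real_normed_vector \<Rightarrow> real"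
  shows "smooth_on f S \<Longrightarrow> open S \<Longrightarrow> smooth_on (\<lambda>x. (f x)\<^sup>2) S"
  by (simp add: power2_eq_square smooth_on_mult)

lemma smooth_on_prod:
  fixes f :: "'i \<Rightarrow> 'a::real_normed_vector \<Rightarrow> real"
  shows "(\<And>i. i \<in> I \<Longrightarrow> smooth_on (f i) S) \<Longrightarrow> open S \<Longrightarrow> smooth_on (\<lambda>x. \<Prod>i\<in>I. f i x) S"
  by (induction I rule: infinite_finite_induct) (auto simp: smooth_on_const smooth_on_mult)

lemma smooth_on_divide:
  fixes f g :: "'a::real_normed_vector \<Rightarrow> real"
  shows "smooth_on f S \<Longrightarrow> smooth_on g S \<Longrightarrow> open S \<Longrightarrow> (\<And>x. x \<in> S \<Longrightarrow> g x \<noteq> 0) \<Longrightarrow>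
    smooth_on (\<lambda>x. f x / g x) S"
  unfolding divide_inverse by (intro smooth_on_mult) (simp_all add: smooth_on_def Ck_on_inverse)

lemma smooth_on_compose:
  fixes g :: "'a::real_normed_vector \<Rightarrow> 'b::euclidean_space"
  shows "smooth_on f T \<Longrightarrow> smooth_on g S \<Longrightarrow> open S \<Longrightarrow> g ` S \<subseteq> T \<Longrightarrow>
    smooth_on (\<lambda>x. f (g x)) S"
  by (simp add: smooth_on_def Ck_on_compose)

lemma smooth_on_Pair:
  assumes "smooth_on f S" "smooth_on g S" "open S"
  shows "smooth_on (\<lambda>x. (f x, g x)) S"
proof -
  have "smooth_on (\<lambda>x. (f x, 0) + (0, g x)) S"
    by (intro smooth_on_add smooth_on_bounded_linear[OF assms(1)]
        smooth_on_bounded_linear[OF assms(2)] assms(3) bounded_linear_Pair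
        bounded_linear_ident bounded_linear_zero)
  then show ?thesis by simp
qed

lemma matrix_inv_left_right:
  assumes "invertible (A :: real ^ 'n ^ 'n)"
  shows "A ** matrix_inv A = mat 1" "matrix_inv A ** A = mat 1"
  using someI_ex[OF assms[unfolded invertible_def]] by (simp_all add: matrix_inv_def)

text \<open>By Cramer's rule the entries of the inverse are quotients of determinants, hence rational
  functions of the entries of the matrix.\<close>

lemma smooth_on_matrix_inv:
  fixes M :: "'a::real_normed_vector \<Rightarrow> real ^ 'n ^ 'n"
  assumes "open S" and M: "\<And>i j. smooth_on (\<lambda>x. M x $ i $ j) S"
    and inv: "\<And>x. x \<in> S \<Longrightarrow> invertible (M x)"
  shows "smooth_on (\<lambda>x. matrix_inv (M x) $ i $ j) S"
proof -
  let ?N = "\<lambda>x. (\<chi> r s. if s = i then axis j 1 $ r else M x $ r $ s) :: real ^ 'n ^ 'n"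
  have det: "smooth_on (\<lambda>x. det (N x)) S"
    if "\<And>i j. smooth_on (\<lambda>x. N x $ i $ j) S" for N :: "'a \<Rightarrow> real ^ 'n ^ 'n"
    unfolding det_def
    by (intro smooth_on_sum smooth_on_mult smooth_on_prod smooth_on_const that assms(1))
  have N: "smooth_on (\<lambda>x. ?N x $ r $ s) S" for r s
    by (cases "s = i") (simp_all add: M smooth_on_const assms(1))
  have nz: "det (M x) \<noteq> 0" if "x \<in> S" for x
    using inv[OF that] by (simp add: invertible_det_nz)
  have "smooth_on (\<lambda>x. det (?N x) / det (M x)) S"
    by (rule smooth_on_divide[OF det det]) (use N M assms(1) nz in auto)
  moreover have "det (?N x) / det (M x) = matrix_inv (M x) $ i $ j" if "x \<in> S" for x
  proof -
    have "M x *v (matrix_inv (M x) *v axis j 1) = axis j 1"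
      using inv[OF that] by (simp add: matrix_vector_mul_assoc matrix_inv_left_right)
    then have "matrix_inv (M x) *v axis j 1
        = (\<chi> k. det (\<chi> r s. if s = k then axis j 1 $ r else M x $ r $ s) / det (M x))"
      by (subst (asm) cramer[OF nz[OF that]])
    then show ?thesis by (simp add: vec_eq_iff matrix_vector_mult_basis column_def)
  qed
  ultimately show ?thesis by (rule smooth_on_cong[OF _ assms(1)])
qed

text \<open>Half of the proof of Schwarz's theorem: two applications of the mean value theorem, first
  along \<open>u\<close> and then along \<open>v\<close>, evaluate the second difference over the parallelogram spanned by
  \<open>h u\<close> and \<open>h v\<close>. The left-hand side is symmetric in \<open>u\<close> and \<open>v\<close>.\<close>

lemma second_difference_mean_value:
  fixes f :: "'a::real_normed_vector \<Rightarrow> real"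
  assumes f: "smooth_on f S" and "h > 0"
    and S: "\<And>a b. 0 \<le> a \<Longrightarrow> a \<le> h \<Longrightarrow> 0 \<le> b \<Longrightarrow> b \<le> h \<Longrightarrow> x + a *\<^sub>R u + b *\<^sub>R v \<in> S"
  obtains a b where "0 \<le> a" "a \<le> h" "0 \<le> b" "b \<le> h"
    "f (x + h *\<^sub>R u + h *\<^sub>R v) - f (x + h *\<^sub>R u) - f (x + h *\<^sub>R v) + f x
      = h * h * frechet_derivative (\<lambda>x. frechet_derivative f (at x) u) (at (x + a *\<^sub>R u + b *\<^sub>R v)) v"
proof -
  define fu where "fu = (\<lambda>x. frechet_derivative f (at x) u)"
  have fu: "smooth_on fu S" unfolding fu_def by (rule smooth_on_frechet_derivative[OF f])
  have D: "((\<lambda>s. g (z + s *\<^sub>R w)) has_real_derivative frechet_derivative g (at (z + s *\<^sub>R w)) w) (at s)"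
    if "smooth_on g S" "z + s *\<^sub>R w \<in> S" for g :: "'a \<Rightarrow> real" and z s w
  proof -
    have 1: "((\<lambda>s. z + s *\<^sub>R w) has_derivative (\<lambda>s. s *\<^sub>R w)) (at s)"
      by (auto intro!: derivative_eq_intros)
    have 2: "linear (frechet_derivative g (at (z + s *\<^sub>R w)))"
      using that smooth_on_differentiable linear_frechet_derivative by blast
    show ?thesis
      using has_derivative_compose[OF 1 smooth_on_has_derivative[OF that]] linear_scale[OF 2]
      by (simp add: has_field_derivative_def mult_commute_abs)
  qed
  have "\<exists>a>0. a < h \<and> (f ((x + h *\<^sub>R v) + h *\<^sub>R u) - f (x + h *\<^sub>R u)) - (f ((x + h *\<^sub>R v) + 0 *\<^sub>R u) - f (x + 0 *\<^sub>R u))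
     = (h - 0) * (fu ((x + h *\<^sub>R v) + a *\<^sub>R u) - fu (x + a *\<^sub>R u))"
    unfolding fu_def
  proof (intro MVT2 \<open>h > 0\<close> DERIV_diff D[OF f])
    fix a assume "0 \<le> a" "a \<le> h"
    then show "x + h *\<^sub>R v + a *\<^sub>R u \<in> S" "x + a *\<^sub>R u \<in> S"
      using S[of a h] S[of a 0] \<open>h > 0\<close> by (simp_all add: add.commute add.left_commute)
  qed
  then obtain a where a: "0 < a" "a < h" and
    1: "f ((x + h *\<^sub>R v) + h *\<^sub>R u) - f (x + h *\<^sub>R u) - (f (x + h *\<^sub>R v) - f x)
     = h * (fu ((x + h *\<^sub>R v) + a *\<^sub>R u) - fu (x + a *\<^sub>R u))" by auto
  have "\<exists>b>0. b < h \<and> fu ((x + a *\<^sub>R u) + h *\<^sub>R v) - fu ((x + a *\<^sub>R u) + 0 *\<^sub>R v)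
     = (h - 0) * frechet_derivative fu (at ((x + a *\<^sub>R u) + b *\<^sub>R v)) v"
    using S[of a] \<open>h > 0\<close> a by (intro MVT2) (auto intro!: D[OF fu])
  then obtain b where b: "0 < b" "b < h" and
    2: "fu ((x + a *\<^sub>R u) + h *\<^sub>R v) - fu (x + a *\<^sub>R u)
     = h * frechet_derivative fu (at ((x + a *\<^sub>R u) + b *\<^sub>R v)) v" by auto
  show thesis
  proof (rule that[of a b])
    show "f (x + h *\<^sub>R u + h *\<^sub>R v) - f (x + h *\<^sub>R u) - f (x + h *\<^sub>R v) + f x
      = h * h * frechet_derivative (\<lambda>x. frechet_derivative f (at x) u) (at (x + a *\<^sub>R u + b *\<^sub>R v)) v"
      using 1 2 by (simp add: ac_simps fu_def)
  qed (use a b in auto)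
qed

text \<open>Schwarz's theorem. By the symmetry of the second difference, each small parallelogram at
  \<open>x\<close> contains two points such that one iterated derivative at the first equals the other one at
  the second; both are continuous at \<open>x\<close>.\<close>

lemma frechet_derivative_commute:
  fixes f :: "'a::real_normed_vector \<Rightarrow> real"
  assumes f: "smooth_on f S" and "open S" "x \<in> S"
  shows "frechet_derivative (\<lambda>x. frechet_derivative f (at x) u) (at x) v
    = frechet_derivative (\<lambda>x. frechet_derivative f (at x) v) (at x) u"
proof -
  define D where "D u v x = frechet_derivative (\<lambda>x. frechet_derivative f (at x) u) (at x) v" for u v x
  have sm: "smooth_on (D u v) S" for u v
    unfolding D_def by (intro smooth_on_frechet_derivative f)
  have *: "\<bar>D u v x - D v u x\<bar> < e" if "e > 0" for e
  proof -
    have "isCont (D u v) x" for u v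
      using smooth_on_imp_continuous_on[OF sm] assms continuous_on_eq_continuous_at by blast
    then have "\<forall>\<^sub>F z in nhds x. dist (D u v z) (D u v x) < e / 2" for u v
      using that tendsto_at_iff_tendsto_nhds[of "D u v" x for u v]
      unfolding isCont_def tendsto_iff by (meson half_gt_zero)
    moreover have "\<forall>\<^sub>F z in nhds x. z \<in> S"
      using assms by (simp add: eventually_nhds_in_open)
    ultimately have "\<forall>\<^sub>F z in nhds x. z \<in> S \<and> dist (D u v z) (D u v x) < e / 2
        \<and> dist (D v u z) (D v u x) < e / 2"
      by (simp add: eventually_conj_iff)
    then obtain r where r: "r > 0" "\<And>z. dist z x < r \<Longrightarrow> z \<in> S \<and> dist (D u v z) (D u v x) < e / 2
        \<and> dist (D v u z) (D v u x) < e / 2"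
      by (auto simp: eventually_nhds_metric)
    \<comment> \<open>the summand 1 avoids a division by zero when \<open>u = v = 0\<close>\<close>
    define h where "h = r / (norm u + norm v + 1)"
    have np: "norm u + norm v + 1 > 0" by (smt (verit) norm_ge_zero)
    have h: "h > 0" "h * (norm u + norm v) < r"
      using r np by (auto simp: h_def field_simps)
    have near: "dist (x + a *\<^sub>R u + b *\<^sub>R v) x < r" if "0 \<le> a" "a \<le> h" "0 \<le> b" "b \<le> h" for a b
    proof -
      have "dist (x + a *\<^sub>R u + b *\<^sub>R v) x = norm (a *\<^sub>R u + b *\<^sub>R v)" by (simp add: dist_norm)
      also have "\<dots> \<le> a * norm u + b * norm v"
        using that norm_triangle_ineq[of "a *\<^sub>R u" "b *\<^sub>R v"] by simp
      also have "\<dots> \<le> h * norm u + h * norm v"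
        using that by (intro add_mono mult_right_mono) auto
      finally show ?thesis using h by (simp add: algebra_simps)
    qed
    have near': "dist (x + a *\<^sub>R v + b *\<^sub>R u) x < r" if "0 \<le> a" "a \<le> h" "0 \<le> b" "b \<le> h" for a b
      using near[of b a] that by (simp add: ac_simps)
    obtain a b where ab: "0 \<le> a" "a \<le> h" "0 \<le> b" "b \<le> h"
      "f (x + h *\<^sub>R u + h *\<^sub>R v) - f (x + h *\<^sub>R u) - f (x + h *\<^sub>R v) + f x
        = h * h * D u v (x + a *\<^sub>R u + b *\<^sub>R v)"
      unfolding D_def
      by (rule second_difference_mean_value[OF f h(1), of x u v]) (use near r in auto)
    obtain a' b' where ab': "0 \<le> a'" "a' \<le> h" "0 \<le> b'" "b' \<le> h"
      "f (x + h *\<^sub>R v + h *\<^sub>R u) - f (x + h *\<^sub>R v) - f (x + h *\<^sub>R u) + f x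
        = h * h * D v u (x + a' *\<^sub>R v + b' *\<^sub>R u)"
      unfolding D_def
      by (rule second_difference_mean_value[OF f h(1), of x v u]) (use near' r in auto)
    have "h * h * D u v (x + a *\<^sub>R u + b *\<^sub>R v) = h * h * D v u (x + a' *\<^sub>R v + b' *\<^sub>R u)"
      using ab(5) ab'(5)[unfolded add.assoc[of x] add.commute[of "h *\<^sub>R v"]]
      unfolding add.assoc[of x] by linarith
    then have "D u v (x + a *\<^sub>R u + b *\<^sub>R v) = D v u (x + a' *\<^sub>R v + b' *\<^sub>R u)"
      using h(1) by simp
    moreover have "dist (D u v (x + a *\<^sub>R u + b *\<^sub>R v)) (D u v x) < e / 2"
      using r(2)[OF near[OF ab(1-4)]] by simp
    moreover have "dist (D v u (x + a' *\<^sub>R v + b' *\<^sub>R u)) (D v u x) < e / 2"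
      using r(2)[OF near'[OF ab'(1-4)]] by simp
    ultimately show ?thesis by (smt (verit) dist_real_def field_sum_of_halves)
  qed
  have "D u v x = D v u x" using *[of "\<bar>D u v x - D v u x\<bar>"] by fastforce
  then show ?thesis by (simp add: D_def)
qed

section \<open>Partial derivatives in induced coordinates\<close>

text \<open>\<^const>\<open>frechet_derivative\<close> is a choice among the derivatives, and functions with the
  same germ have the same derivatives, whether or not there are any.\<close>

lemma frechet_derivative_cong:
  assumes "open S" "x \<in> S" "\<And>z. z \<in> S \<Longrightarrow> f z = g z"
  shows "frechet_derivative f (at x) = frechet_derivative g (at x)"
proof -
  have "(f has_derivative D) (at x) \<longleftrightarrow> (g has_derivative D) (at x)" for D
    using has_derivative_transform_within_open[of f D x UNIV S g]
      has_derivative_transform_within_open[of g D x UNIV S f] assms by auto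
  then show ?thesis by (simp add: frechet_derivative_def)
qed

lemma dx_cong: "open S \<Longrightarrow> q \<in> S \<Longrightarrow> (\<And>z. z \<in> S \<Longrightarrow> f z = g z) \<Longrightarrow> dx i f q = dx i g q"
  unfolding dx_def using frechet_derivative_cong by metis

lemma dy_cong: "open S \<Longrightarrow> q \<in> S \<Longrightarrow> (\<And>z. z \<in> S \<Longrightarrow> f z = g z) \<Longrightarrow> dy i f q = dy i g q"
  unfolding dy_def using frechet_derivative_cong by metis

lemma smooth_on_dx: "smooth_on f S \<Longrightarrow> smooth_on (dx i f) S"
  and smooth_on_dy: "smooth_on f S \<Longrightarrow> smooth_on (dy i f) S"
  unfolding dx_def dy_def by (rule smooth_on_frechet_derivative; simp)+

lemma dy_dx_commute:
  "smooth_on f S \<Longrightarrow> open S \<Longrightarrow> q \<in> S \<Longrightarrow> dy i (dx j f) q = dx j (dy i f) q"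
  and dy_dy_commute:
  "smooth_on f S \<Longrightarrow> open S \<Longrightarrow> q \<in> S \<Longrightarrow> dy i (dy j f) q = dy j (dy i f) q"
  unfolding dx_def dy_def by (rule frechet_derivative_commute; simp)+

lemma dx_mult:
  assumes "smooth_on f S" "smooth_on g S" "q \<in> S"
  shows "dx i (\<lambda>q. f q * g q) q = f q * dx i g q + dx i f q * g q"
  unfolding dx_def
  by (rule frechet_derivativeI has_derivative_mult smooth_on_has_derivative assms)+

lemma dy_mult:
  assumes "smooth_on f S" "smooth_on g S" "q \<in> S"
  shows "dy i (\<lambda>q. f q * g q) q = f q * dy i g q + dy i f q * g q"
  unfolding dy_def
  by (rule frechet_derivativeI has_derivative_mult smooth_on_has_derivative assms)+

lemma dy_cmult:
  assumes "smooth_on f S" "q \<in> S"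
  shows "dy i (\<lambda>q. a * f q) q = a * dy i f q"
  unfolding dy_def
  by (rule frechet_derivativeI has_derivative_mult_right smooth_on_has_derivative assms)+

lemma dy_add:
  assumes "smooth_on f S" "smooth_on g S" "q \<in> S"
  shows "dy i (\<lambda>q. f q + g q) q = dy i f q + dy i g q"
  unfolding dy_def
  by (rule frechet_derivativeI has_derivative_add smooth_on_has_derivative assms)+

lemma dx_sum:
  assumes "\<And>k. k \<in> I \<Longrightarrow> smooth_on (f k) S" "q \<in> S"
  shows "dx i (\<lambda>q. \<Sum>k\<in>I. f k q) q = (\<Sum>k\<in>I. dx i (f k) q)"
  unfolding dx_def
  by (rule frechet_derivativeI has_derivative_sum smooth_on_has_derivative assms | assumption)+

lemma dy_sum:
  assumes "\<And>k. k \<in> I \<Longrightarrow> smooth_on (f k) S" "q \<in> S"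
  shows "dy i (\<lambda>q. \<Sum>k\<in>I. f k q) q = (\<Sum>k\<in>I. dy i (f k) q)"
  unfolding dy_def
  by (rule frechet_derivativeI has_derivative_sum smooth_on_has_derivative assms | assumption)+

lemma bounded_linear_fibre_coordinate:
  "bounded_linear (\<lambda>q::'a::real_normed_vector \<times> (real ^ 'n). snd q $ j)"
  by (rule bounded_linear_compose[OF bounded_linear_vec_nth bounded_linear_snd])

lemma smooth_on_fibre_coordinate:
  fixes S :: "('a::real_normed_vector \<times> (real ^ 'n::finite)) set"
  shows "open S \<Longrightarrow> smooth_on (\<lambda>q. snd q $ j) S"
  by (rule smooth_on_linear[OF bounded_linear_fibre_coordinate])

lemma dy_fibre_coordinate: "dy i (\<lambda>q. snd q $ j) q = (if i = j then 1 else 0)"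
  unfolding dy_def
  by (subst frechet_derivativeI[OF bounded_linear_imp_has_derivative[OF bounded_linear_fibre_coordinate]])
    (simp add: axis_def)

lemma has_derivative_base_function:
  fixes h :: "'a::real_normed_vector \<Rightarrow> real"
  assumes "smooth_on h V" "fst q \<in> V"
  shows "((\<lambda>q. h (fst q)) has_derivative (\<lambda>v. frechet_derivative h (at (fst q)) (fst v))) (at q)"
  using has_derivative_compose[OF has_derivative_fst[OF has_derivative_ident]
      smooth_on_has_derivative[OF assms]] by simp

text \<open>Jacobians of coordinate changes are functions of the base point alone; they behave as
  constants under fibre derivatives.\<close>

lemma dx_base_function:
  assumes "smooth_on h V" "fst q \<in> V"
  shows "dx i (\<lambda>q. h (fst q)) q = frechet_derivative h (at (fst q)) (axis i 1)"
  unfolding dx_def using frechet_derivativeI[OF has_derivative_base_function[OF assms]] by simp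

lemma dy_base_function:
  assumes "smooth_on h V" "fst q \<in> V"
  shows "dy i (\<lambda>q. h (fst q)) q = 0"
  using frechet_derivativeI[OF has_derivative_base_function[OF assms], of "(0, axis i 1)"]
    linear_0[OF linear_frechet_derivative[OF smooth_on_differentiable[OF assms]]]
  by (simp add: dy_def)

lemma smooth_on_base_function:
  fixes V :: "'a::euclidean_space set" and S :: "('a \<times> 'b::euclidean_space) set"
  assumes "smooth_on h V" "open S" "fst ` S \<subseteq> V"
  shows "smooth_on (\<lambda>q. h (fst q)) S"
  by (rule smooth_on_compose[OF assms(1) smooth_on_linear[OF bounded_linear_fst] assms(2)])
    (use assms in auto)

lemma linear_axis_expansion:
  assumes "linear (g :: real ^ 'n \<Rightarrow> 'b::real_vector)"
  shows "g v = (\<Sum>m\<in>UNIV. v $ m *\<^sub>R g (axis m 1))"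
proof -
  have "g (\<Sum>m\<in>UNIV. v $ m *\<^sub>R axis m 1) = (\<Sum>m\<in>UNIV. v $ m *\<^sub>R g (axis m 1))"
    by (simp only: linear_sum[OF assms] linear_scale[OF assms])
  moreover have "(\<Sum>m\<in>UNIV. v $ m *\<^sub>R axis m 1) = v"
    using basis_expansion[of v] by (simp add: scalar_mult_eq_scaleR)
  ultimately show ?thesis by simp
qed

lemma frechet_derivative_dx_dy:
  fixes g :: "(real ^ 'n::finite) \<times> (real ^ 'n) \<Rightarrow> real"
  assumes "g differentiable (at p)"
  shows "frechet_derivative g (at p) v
    = (\<Sum>m\<in>UNIV. fst v $ m * dx m g p) + (\<Sum>m\<in>UNIV. snd v $ m * dy m g p)"
proof -
  let ?D = "frechet_derivative g (at p)"
  have lin: "linear ?D" using assms by (rule linear_frechet_derivative)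
  have 1: "linear (\<lambda>u. ?D (u, 0))"
    by (rule linear_compose[OF _ lin, unfolded o_def]) (auto intro!: linearI)
  have 2: "linear (\<lambda>w. ?D (0, w))"
    by (rule linear_compose[OF _ lin, unfolded o_def]) (auto intro!: linearI)
  have "?D v = ?D (fst v, 0) + ?D (0, snd v)"
    by (subst linear_add[OF lin, symmetric]) simp
  then show ?thesis
    using linear_axis_expansion[OF 1, of "fst v"] linear_axis_expansion[OF 2, of "snd v"]
    by (simp add: dx_def dy_def)
qed

section \<open>Finsler functions in one chart\<close>

text \<open>The spray and its transformation law belong to any smooth function with a non-degenerate
  metric; homogeneity enters with Euler's relations.\<close>

locale nondegenerate_function =
  fixes f :: "(real ^ 'n::finite) \<times> (real ^ 'n) \<Rightarrow> real"
    and S :: "((real ^ 'n) \<times> (real ^ 'n)) set"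
  assumes open_S: "open S"
    and smooth_f: "smooth_on f S"
    and invertible_metric: "q \<in> S \<Longrightarrow> invertible (metric f q)"
begin

definition L where "L q = (f q)\<^sup>2"

text \<open>The covector \<open>4 g\<^sub>h\<^sub>i G\<^sup>i\<close>: the Euler-Lagrange expression of \<open>L\<close> without its acceleration
  term. It is free of the inverse metric, which makes it the convenient object to transform.\<close>

definition spray_covector where
  "spray_covector h q = (\<Sum>r\<in>UNIV. snd q $ r * dx r (dy h L) q) - dx h L q"

lemma smooth_L: "smooth_on L S"
  unfolding L_def using smooth_on_power2[OF smooth_f open_S] .

lemma L_eq: "L = (\<lambda>q. (f q)\<^sup>2)"
  by (simp add: L_def fun_eq_iff)

lemma metric_eq: "metric f q $ i $ j = 1/2 * dy i (dy j L) q"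
  by (simp add: metric_def L_eq)

lemma smooth_metric: "smooth_on (\<lambda>q. metric f q $ i $ j) S"
  unfolding metric_eq
  by (intro smooth_on_mult smooth_on_const smooth_on_dy smooth_L open_S)

lemma smooth_metric_inv: "smooth_on (\<lambda>q. metric_inv f q $ i $ j) S"
  unfolding metric_inv_def
  by (intro smooth_on_matrix_inv smooth_metric open_S invertible_metric)

lemma metric_symmetric: "q \<in> S \<Longrightarrow> metric f q $ i $ j = metric f q $ j $ i"
  unfolding metric_eq using dy_dy_commute[OF smooth_L open_S] by simp

lemma metric_inv:
  assumes "q \<in> S"
  shows "metric f q ** metric_inv f q = mat 1" "metric_inv f q ** metric f q = mat 1"
  using matrix_inv_left_right[OF invertible_metric[OF assms]] by (simp_all add: metric_inv_def)

lemma metric_inv_symmetric: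
  assumes "q \<in> S"
  shows "metric_inv f q $ i $ j = metric_inv f q $ j $ i"
proof -
  let ?g = "metric f q" and ?h = "metric_inv f q"
  have t: "transpose ?g = ?g"
    using metric_symmetric[OF assms] by (simp add: vec_eq_iff transpose_def)
  have "transpose ?h = transpose ?h ** (?g ** ?h)" by (simp add: metric_inv[OF assms])
  also have "\<dots> = transpose (?g ** ?h) ** ?h"
    by (simp only: matrix_transpose_mul t matrix_mul_assoc)
  also have "\<dots> = ?h" by (simp add: metric_inv[OF assms] transpose_mat)
  finally have "transpose ?h $ i $ j = ?h $ i $ j" by simp
  then show ?thesis by (simp add: transpose_def)
qed

lemma spray_eq: "spray f i q = 1/4 * (\<Sum>h\<in>UNIV. metric_inv f q $ i $ h * spray_covector h q)"
  by (simp add: spray_def spray_covector_def L_eq)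

lemma metric_spray:
  assumes "q \<in> S"
  shows "metric f q *v (\<chi> i. spray f i q) = (1/4) *\<^sub>R (\<chi> h. spray_covector h q)"
proof -
  have "(\<chi> i. spray f i q) = (1/4) *\<^sub>R (metric_inv f q *v (\<chi> h. spray_covector h q))"
    by (simp add: spray_eq vec_eq_iff matrix_vector_mult_def)
  then show ?thesis
    by (simp add: matrix_vector_mult_scaleR matrix_vector_mul_assoc metric_inv[OF assms])
qed

lemma smooth_spray: "smooth_on (spray f i) S"
proof -
  have "smooth_on (\<lambda>q. 1/4 * (\<Sum>h\<in>UNIV. metric_inv f q $ i $ h * spray_covector h q)) S"
    unfolding spray_covector_def
    by (intro smooth_on_mult smooth_on_sum smooth_on_const smooth_on_diff smooth_on_dx smooth_on_dy
        smooth_metric_inv smooth_L smooth_on_fibre_coordinate open_S)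
  then show ?thesis by (simp add: spray_eq[abs_def])
qed

lemma smooth_berwald: "smooth_on (berwald f i j k) S"
  unfolding berwald_def by (intro smooth_on_dy smooth_spray)

lemma smooth_cartan_up: "smooth_on (cartan_up f i j k) S"
  unfolding cartan_up_def[abs_def] cartan_def[abs_def]
  by (intro smooth_on_sum smooth_on_mult smooth_on_const smooth_on_dy smooth_metric
      smooth_metric_inv open_S)

end

locale finsler_function = nondegenerate_function +
  assumes positive: "q \<in> S \<Longrightarrow> f q > 0"
    and homogeneous: "(x, y) \<in> S \<Longrightarrow> l > 0 \<Longrightarrow> f (x, l *\<^sub>R y) = l * f (x, y)"
begin

text \<open>Euler's relation: differentiate \<open>f (x, l y) = l f (x, y)\<close> with respect to \<open>l\<close> at \<open>l = 1\<close>.\<close>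

lemma euler_f:
  assumes q: "q \<in> S"
  shows "(\<Sum>j\<in>UNIV. snd q $ j * dy j f q) = f q"
proof -
  have "((\<lambda>l::real. (fst q, l *\<^sub>R snd q)) has_derivative (\<lambda>l. (0, l *\<^sub>R snd q))) (at 1)"
    by (auto intro!: derivative_eq_intros)
  moreover have "(f has_derivative frechet_derivative f (at q)) (at (fst q, 1 *\<^sub>R snd q))"
    using smooth_on_has_derivative[OF smooth_f q] by simp
  ultimately have "((\<lambda>l. f (fst q, l *\<^sub>R snd q)) has_derivative
      (\<lambda>l. frechet_derivative f (at q) (0, l *\<^sub>R snd q))) (at 1)"
    by (rule has_derivative_compose)
  moreover have "((\<lambda>l. l * f q) has_derivative (\<lambda>l. l * f q)) (at 1)"
    by (auto intro!: derivative_eq_intros)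
  then have "((\<lambda>l. f (fst q, l *\<^sub>R snd q)) has_derivative (\<lambda>l. l * f q)) (at 1)"
    by (rule has_derivative_transform_within_open[where s="{0<..}"])
      (use homogeneous[of "fst q" "snd q"] q in auto)
  ultimately have "(\<lambda>l. frechet_derivative f (at q) (0, l *\<^sub>R snd q)) = (\<lambda>l. l * f q)"
    by (rule has_derivative_unique)
  from fun_cong[OF this, of 1] show ?thesis
    using frechet_derivative_dx_dy[OF smooth_on_differentiable[OF smooth_f q], of "(0, snd q)"]
    by simp
qed

lemma dy_L: "q \<in> S \<Longrightarrow> dy h L q = 2 * f q * dy h f q"
  and dx_L: "q \<in> S \<Longrightarrow> dx h L q = 2 * f q * dx h f q"
  unfolding L_eq power2_eq_square
  using dy_mult[OF smooth_f smooth_f] dx_mult[OF smooth_f smooth_f] by simp_all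

lemma euler_L: "q \<in> S \<Longrightarrow> (\<Sum>j\<in>UNIV. snd q $ j * dy j L q) = 2 * L q"
  using euler_f[of q] sum_distrib_left[of "2 * f q" "\<lambda>j. snd q $ j * dy j f q" UNIV, symmetric]
  by (simp add: dy_L L_def power2_eq_square mult_ac)

text \<open>A fibre derivative of Euler's relation for \<open>L\<close>. In terms of the metric it says that \<open>2 y\<^sub>h\<close>
  is the fibre derivative of \<open>L\<close>.\<close>

lemma euler_dy_L:
  assumes q: "q \<in> S"
  shows "(\<Sum>j\<in>UNIV. snd q $ j * dy h (dy j L) q) = dy h L q"
proof -
  note sm = smooth_on_fibre_coordinate[OF open_S] smooth_on_dy[OF smooth_L]
  have "dy h (\<lambda>q. \<Sum>j\<in>UNIV. snd q $ j * dy j L q) q = dy h (\<lambda>q. 2 * L q) q"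
    by (rule dy_cong[OF open_S q euler_L])
  also have "\<dots> = 2 * dy h L q" by (rule dy_cmult[OF smooth_L q])
  also have "dy h (\<lambda>q. \<Sum>j\<in>UNIV. snd q $ j * dy j L q) q
      = (\<Sum>j\<in>UNIV. snd q $ j * dy h (dy j L) q + (if h = j then 1 else 0) * dy j L q)"
    by (subst dy_sum[OF smooth_on_mult[OF sm open_S] q])
      (simp add: dy_mult[OF sm q] dy_fibre_coordinate)
  finally show ?thesis by (simp add: sum.distrib mult_if_delta)
qed

lemma y_low_eq: "q \<in> S \<Longrightarrow> y_low f i q = 1/2 * dy i L q"
  unfolding y_low_def metric_eq using euler_dy_L[of q i]
  by (simp add: sum_divide_distrib[symmetric] mult.commute)

lemma dy_y_low:
  assumes q: "q \<in> S"
  shows "dy j (y_low f i) q = metric f q $ i $ j"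
proof -
  have "dy j (y_low f i) q = dy j (\<lambda>q. 1/2 * dy i L q) q"
    by (rule dy_cong[OF open_S q y_low_eq])
  also have "\<dots> = metric f q $ j $ i"
    unfolding metric_eq by (rule dy_cmult[OF smooth_on_dy[OF smooth_L] q])
  finally show ?thesis using metric_symmetric[OF q] by simp
qed

lemma smooth_y_low: "smooth_on (y_low f i) S"
  unfolding y_low_def
  by (intro smooth_on_sum smooth_on_mult smooth_metric smooth_on_fibre_coordinate open_S)

end

section \<open>Projectively flat functions\<close>

locale projectively_flat_function = finsler_function f S
  for f :: "(real ^ 'n::finite) \<times> (real ^ 'n) \<Rightarrow> real" and S +
  fixes P :: "(real ^ 'n) \<times> (real ^ 'n) \<Rightarrow> real"
  assumes flat: "q \<in> S \<Longrightarrow> (\<Sum>k\<in>UNIV. snd q $ k * dy i (dx k f) q) = dx i f q"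
    and factor: "q \<in> S \<Longrightarrow> P q = (\<Sum>i\<in>UNIV. snd q $ i * dx i f q) / (2 * f q)"
begin

lemma smooth_P: "smooth_on P S"
proof -
  have "smooth_on (\<lambda>q. (\<Sum>i\<in>UNIV. snd q $ i * dx i f q) / (2 * f q)) S"
    by (intro smooth_on_divide smooth_on_sum smooth_on_mult smooth_on_const smooth_on_dx smooth_f
      smooth_on_fibre_coordinate open_S) (auto dest: positive)
  then show ?thesis by (rule smooth_on_cong[OF _ open_S]) (simp add: factor)
qed

text \<open>Inserting \<open>\<partial>L/\<partial>y\<^sup>h = 2 f \<partial>f/\<partial>y\<^sup>h\<close> produces \<open>2 (y\<^sup>r \<partial>\<^sub>r f) \<partial>f/\<partial>y\<^sup>h\<close>, where \<open>y\<^sup>r \<partial>\<^sub>r f = 2 f P\<close>,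
  and the term \<open>2 f y\<^sup>r \<partial>\<^sup>2f/\<partial>x\<^sup>r\<partial>y\<^sup>h\<close>, which the flatness equation equates with \<open>\<partial>L/\<partial>x\<^sup>h\<close> so that it
  cancels.\<close>

lemma spray_covector_flat:
  assumes q: "q \<in> S"
  shows "spray_covector h q = 4 * P q * y_low f h q"
proof -
  have D: "dx r (dy h L) q = 2 * dx r f q * dy h f q + 2 * f q * dy h (dx r f) q" for r
  proof -
    have "dx r (dy h L) q = dx r (\<lambda>q. (2 * f q) * dy h f q) q"
      by (rule dx_cong[OF open_S q dy_L])
    also have "\<dots> = 2 * f q * dx r (dy h f) q + dx r (\<lambda>q. 2 * f q) q * dy h f q"
      by (rule dx_mult[OF smooth_on_mult[OF smooth_on_const smooth_f] smooth_on_dy[OF smooth_f] q])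
        (rule open_S)+
    also have "dx r (\<lambda>q. 2 * f q) q = 2 * dx r f q"
      unfolding dx_def
      by (rule frechet_derivativeI has_derivative_mult_right smooth_on_has_derivative[OF smooth_f q])+
    finally show ?thesis by (simp add: dy_dx_commute[OF smooth_f open_S q])
  qed
  have "(\<Sum>r\<in>UNIV. snd q $ r * dx r (dy h L) q)
     = 2 * dy h f q * (\<Sum>r\<in>UNIV. snd q $ r * dx r f q)
       + 2 * f q * (\<Sum>r\<in>UNIV. snd q $ r * dy h (dx r f) q)"
    by (simp add: D sum_distrib_left sum.distrib[symmetric] algebra_simps)
  also have "(\<Sum>r\<in>UNIV. snd q $ r * dx r f q) = 2 * f q * P q"
    using positive[OF q] by (simp add: factor[OF q])
  finally show ?thesis
    by (simp add: spray_covector_def flat[OF q] dx_L[OF q] y_low_eq[OF q] dy_L[OF q])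
qed

lemma spray_flat:
  assumes q: "q \<in> S"
  shows "spray f i q = P q * snd q $ i"
proof -
  have y: "(\<chi> h. y_low f h q) = metric f q *v snd q"
    by (simp add: vec_eq_iff matrix_vector_mult_def y_low_def)
  have "spray f i q = P q * (metric_inv f q *v (\<chi> h. y_low f h q)) $ i"
    by (simp add: spray_eq spray_covector_flat[OF q] matrix_vector_mult_def sum_distrib_left
        algebra_simps)
  then show ?thesis by (simp add: y matrix_vector_mul_assoc metric_inv[OF q])
qed

lemma H_low_flat: "q \<in> S \<Longrightarrow> H_low f i q = P q * y_low f i q"
  by (simp add: H_low_def y_low_def spray_flat sum_distrib_left algebra_simps)

text \<open>Used for \<open>w = y\<^sup>i\<close>, where it gives the Berwald coefficients, and for \<open>w = y\<^sub>r\<close>, where it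
  gives \<open>H\<^sub>r\<^sub>j\<^sub>k\<close>. The second fibre derivative of \<open>w\<close> makes the difference: it vanishes for \<open>y\<^sup>i\<close>
  and is \<open>2 C\<^sub>r\<^sub>j\<^sub>k\<close> for \<open>y\<^sub>r\<close>.\<close>

lemma dy_dy_P_mult:
  assumes w: "smooth_on w S" and q: "q \<in> S"
  shows "dy k (dy j (\<lambda>q. P q * w q)) q
    = dy k (dy j P) q * w q + dy j P q * dy k w q + dy k P q * dy j w q + P q * dy k (dy j w) q"
proof -
  have "dy k (dy j (\<lambda>q. P q * w q)) q = dy k (\<lambda>q. P q * dy j w q + dy j P q * w q) q"
    by (rule dy_cong[OF open_S q dy_mult[OF smooth_P w]])
  also have "\<dots> = (P q * dy k (dy j w) q + dy k P q * dy j w q)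
      + (dy j P q * dy k w q + dy k (dy j P) q * w q)"
    by (subst dy_add[where S=S])
      (auto intro!: smooth_on_mult smooth_on_dy smooth_P w q open_S
        simp: dy_mult[OF smooth_P smooth_on_dy[OF w] q] dy_mult[OF smooth_on_dy[OF smooth_P] w q])
  finally show ?thesis by simp
qed

lemma dy_const: "dy k (\<lambda>q. a) q = 0"
  by (simp add: dy_def)

lemma berwald_flat:
  assumes q: "q \<in> S"
  shows "berwald f i j k q = dy k (dy j P) q * snd q $ i
    + dy j P q * (if i = k then 1 else 0) + dy k P q * (if i = j then 1 else 0)"
proof -
  have "dy j (spray f i) z = dy j (\<lambda>q. P q * snd q $ i) z" if "z \<in> S" for z
    by (rule dy_cong[OF open_S that spray_flat])
  then have "berwald f i j k q = dy k (dy j (\<lambda>q. P q * snd q $ i)) q"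
    unfolding berwald_def by (intro dy_cong[OF open_S q])
  also have "dy j (\<lambda>q. snd q $ i) = (\<lambda>q. if j = i then 1 else 0)"
    by (simp add: dy_fibre_coordinate fun_eq_iff)
  ultimately show ?thesis
    by (simp add: dy_dy_P_mult[OF smooth_on_fibre_coordinate[OF open_S] q] dy_fibre_coordinate
      dy_const eq_commute)
qed

lemma H_low3_flat:
  assumes q: "q \<in> S"
  shows "H_low3 f r j k q = dy k (dy j P) q * y_low f r q + dy j P q * metric f q $ r $ k
    + dy k P q * metric f q $ r $ j + 2 * P q * cartan f r j k q"
proof -
  have "dy j (H_low f r) z = dy j (\<lambda>q. P q * y_low f r q) z" if "z \<in> S" for z
    by (rule dy_cong[OF open_S that H_low_flat])
  then have "H_low3 f r j k q = dy k (dy j (\<lambda>q. P q * y_low f r q)) q"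
    unfolding H_low3_def by (intro dy_cong[OF open_S q])
  moreover have "dy k (dy j (y_low f r)) q = 2 * cartan f r j k q"
    unfolding cartan_def by (simp add: dy_cong[OF open_S q dy_y_low])
  ultimately show ?thesis
    by (simp add: dy_dy_P_mult[OF smooth_y_low q] dy_y_low[OF q])
qed

text \<open>Raising the index \<open>r\<close> turns \<open>y\<^sub>r\<close> into \<open>y\<^sup>i\<close> and \<open>g\<^sub>r\<^sub>k\<close> into \<open>\<delta>\<^sup>i\<^sub>k\<close>, which is how the three
  terms of \<open>H\<^sub>r\<^sub>j\<^sub>k\<close> without the Cartan tensor become the Berwald coefficients.\<close>

theorem H_coeff_flat:
  assumes q: "q \<in> S"
  shows "H_coeff f i j k q = berwald f i j k q + 2 * P q * cartan_up f i j k q"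
proof -
  let ?h = "\<lambda>r. metric_inv f q $ i $ r"
  have delta: "(\<Sum>r\<in>UNIV. ?h r * metric f q $ r $ l) = (if i = l then 1 else 0)" for l
    using metric_inv(2)[OF q] by (simp add: vec_eq_iff matrix_matrix_mult_def mat_def)
  have y: "(\<Sum>r\<in>UNIV. ?h r * y_low f r q) = snd q $ i"
  proof -
    have "(\<Sum>r\<in>UNIV. ?h r * y_low f r q) = (metric_inv f q *v (metric f q *v snd q)) $ i"
      by (simp add: matrix_vector_mult_def y_low_def)
    then show ?thesis by (simp add: matrix_vector_mul_assoc metric_inv[OF q])
  qed
  have "H_coeff f i j k q = (\<Sum>r\<in>UNIV. ?h r * H_low3 f r j k q)"
    unfolding H_coeff_def using metric_inv_symmetric[OF q] by simp
  also have "\<dots> = dy k (dy j P) q * (\<Sum>r\<in>UNIV. ?h r * y_low f r q)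
      + dy j P q * (\<Sum>r\<in>UNIV. ?h r * metric f q $ r $ k)
      + dy k P q * (\<Sum>r\<in>UNIV. ?h r * metric f q $ r $ j)
      + 2 * P q * (\<Sum>r\<in>UNIV. ?h r * cartan f r j k q)"
    unfolding H_low3_flat[OF q] sum_distrib_left sum.distrib[symmetric]
    by (intro sum.cong refl) (simp add: algebra_simps)
  also have "(\<Sum>r\<in>UNIV. ?h r * cartan f r j k q) = cartan_up f i j k q"
    by (simp add: cartan_up_def)
  finally show ?thesis by (simp add: y delta berwald_flat[OF q])
qed

end

section \<open>Change of coordinates\<close>

text \<open>Here \<open>t\<close> is a coordinate change \<open>x \<mapsto> x'\<close> and \<open>\<Phi>\<close> the induced change of the coordinates
  \<open>(x, y)\<close>, with \<open>y'\<^sup>m = J\<^sup>m\<^sub>s y\<^sup>s\<close>. Every law expresses the objects of the old chart, contracted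
  with \<open>J\<close> where they carry an upper index, through those of the new chart at \<open>\<Phi> q\<close>; so the
  inverse Jacobian never appears.\<close>

lemma smooth_on_vec:
  fixes g :: "'a::real_normed_vector \<Rightarrow> real ^ 'n"
  assumes "\<And>m. smooth_on (\<lambda>x. g x $ m) S" "open S"
  shows "smooth_on g S"
proof -
  have "smooth_on (\<lambda>x. \<Sum>m\<in>UNIV. g x $ m *\<^sub>R axis m 1) S"
    by (intro smooth_on_sum smooth_on_scaleR smooth_on_const assms)
  then show ?thesis
    by (rule smooth_on_cong[OF _ assms(2)])
      (rule linear_axis_expansion[OF linear_id[unfolded id_def], symmetric])
qed

lemma frechet_derivative_vec_nth:
  fixes g :: "'a::real_normed_vector \<Rightarrow> real ^ 'n"
  assumes "smooth_on g S" "x \<in> S"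
  shows "frechet_derivative (\<lambda>x. g x $ m) (at x) v = frechet_derivative g (at x) v $ m"
  by (rule frechet_derivativeI
      bounded_linear.has_derivative[OF bounded_linear_vec_nth] smooth_on_has_derivative assms)+

lemma sum_mult_sum_swap:
  fixes y :: "'a \<Rightarrow> real"
  shows "(\<Sum>r\<in>A. y r * (\<Sum>m\<in>M. c m r * a m)) = (\<Sum>m\<in>M. (\<Sum>r\<in>A. y r * c m r) * a m)"
    and "(\<Sum>r\<in>A. y r * (\<Sum>m\<in>M. b m * z m r)) = (\<Sum>m\<in>M. b m * (\<Sum>r\<in>A. y r * z m r))"
  unfolding sum_distrib_left sum_distrib_right
  by (subst sum.swap, simp add: mult_ac)+

lemma sum_mult_add_sum_swap:
  fixes y :: "'a \<Rightarrow> real"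
  shows "(\<Sum>r\<in>A. y r * ((\<Sum>m\<in>M. b m * z m r) + (\<Sum>m\<in>M. c m r * a m)))
    = (\<Sum>m\<in>M. b m * (\<Sum>r\<in>A. y r * z m r)) + (\<Sum>m\<in>M. (\<Sum>r\<in>A. y r * c m r) * a m)"
  unfolding distrib_left sum.distrib
  by (simp only: sum_mult_sum_swap(1)[of y c] sum_mult_sum_swap(2)[of y b])

lemma invertible_transpose: "invertible (A :: real ^ 'n ^ 'n) \<Longrightarrow> invertible (transpose A)"
  by (simp add: invertible_det_nz)

locale coordinate_change =
  fixes t :: "real ^ 'n::finite \<Rightarrow> real ^ 'n" and V :: "(real ^ 'n) set"
    and W :: "((real ^ 'n) \<times> (real ^ 'n)) set"
  assumes open_V: "open V" and smooth_t: "smooth_on t V"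
    and open_W: "open W" and fst_W: "q \<in> W \<Longrightarrow> fst q \<in> V"
begin

definition J where "J x = matrix (frechet_derivative t (at x))"

text \<open>The second derivatives \<open>\<partial>\<^sup>2x'\<^sup>m/\<partial>x\<^sup>h\<partial>x\<^sup>s\<close>.\<close>

definition B where "B m h s x = frechet_derivative (\<lambda>x. J x $ m $ s) (at x) (axis h 1)"

text \<open>The base derivatives \<open>\<partial>y'\<^sup>m/\<partial>x\<^sup>h\<close> of the new fibre coordinates.\<close>

definition K where "K m h q = (\<Sum>s\<in>UNIV. snd q $ s * B m h s (fst q))"

definition \<Phi> where "\<Phi> q = (t (fst q), frechet_derivative t (at (fst q)) (snd q))"

lemma J_entry: "J x $ m $ j = frechet_derivative t (at x) (axis j 1) $ m"
  by (simp add: J_def matrix_def)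

lemma J_mult: "x \<in> V \<Longrightarrow> J x *v y = frechet_derivative t (at x) y"
  unfolding J_def
  using linear_frechet_derivative[OF smooth_on_differentiable[OF smooth_t]]
  by (simp add: matrix_works linear_matrix_vector_mul_eq)

lemma smooth_J: "smooth_on (\<lambda>x. J x $ m $ j) V"
  unfolding J_entry
  by (intro smooth_on_bounded_linear[OF smooth_on_frechet_derivative[OF smooth_t]]
      bounded_linear_vec_nth open_V)

lemma smooth_J_W: "smooth_on (\<lambda>q. J (fst q) $ m $ j) W"
  by (rule smooth_on_base_function[OF smooth_J open_W]) (use fst_W in auto)

lemma B_symmetric:
  assumes "x \<in> V"
  shows "B m h s x = B m s h x"
proof -
  have "B m h s x = frechet_derivative (\<lambda>x. frechet_derivative (\<lambda>x. t x $ m) (at x) (axis s 1))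
      (at x) (axis h 1)" for h s
    unfolding B_def J_entry
    by (subst frechet_derivative_cong[OF open_V assms])
      (simp_all add: frechet_derivative_vec_nth[OF smooth_t])
  then show ?thesis
    using frechet_derivative_commute[OF smooth_on_bounded_linear[OF smooth_t bounded_linear_vec_nth open_V]
      open_V assms] by simp
qed

lemma snd_\<Phi>: "q \<in> W \<Longrightarrow> snd (\<Phi> q) $ m = (\<Sum>s\<in>UNIV. snd q $ s * J (fst q) $ m $ s)"
  using J_mult[OF fst_W, of q "snd q", symmetric]
  by (simp add: \<Phi>_def matrix_vector_mult_def mult.commute)

lemma smooth_fst_\<Phi>: "smooth_on (\<lambda>q. t (fst q)) W"
  by (rule smooth_on_base_function[OF smooth_t open_W]) (use fst_W in auto)

lemma smooth_snd_\<Phi>: "smooth_on (\<lambda>q. snd (\<Phi> q)) W"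
proof (rule smooth_on_vec[OF _ open_W])
  fix m
  have "smooth_on (\<lambda>q. \<Sum>s\<in>UNIV. snd q $ s * J (fst q) $ m $ s) W"
    by (intro smooth_on_sum smooth_on_mult smooth_on_fibre_coordinate smooth_J_W open_W)
  then show "smooth_on (\<lambda>q. snd (\<Phi> q) $ m) W"
    by (rule smooth_on_cong[OF _ open_W]) (simp add: snd_\<Phi>)
qed

lemma smooth_\<Phi>: "smooth_on \<Phi> W"
  using smooth_on_Pair[OF smooth_fst_\<Phi> smooth_snd_\<Phi> open_W] by (simp add: \<Phi>_def[abs_def])

text \<open>The chain rule in induced coordinates; the four blocks of the Jacobian of \<open>\<Phi>\<close> that it
  involves are computed next. The vanishing block \<open>\<partial>x'/\<partial>y\<close> is what makes fibre derivatives
  transform by the Jacobian of \<open>t\<close> alone.\<close>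

lemma frechet_derivative_compose_\<Phi>:
  assumes g: "smooth_on g W'" and "q \<in> W" "\<Phi> q \<in> W'"
  shows "frechet_derivative (\<lambda>q. g (\<Phi> q)) (at q) v
    = (\<Sum>m\<in>UNIV. frechet_derivative (\<lambda>q. t (fst q) $ m) (at q) v * dx m g (\<Phi> q))
    + (\<Sum>m\<in>UNIV. frechet_derivative (\<lambda>q. snd (\<Phi> q) $ m) (at q) v * dy m g (\<Phi> q))"
proof -
  have "\<Phi> = (\<lambda>q. (t (fst q), snd (\<Phi> q)))" by (simp add: \<Phi>_def fun_eq_iff)
  then have "(\<Phi> has_derivative (\<lambda>v. (frechet_derivative (\<lambda>q. t (fst q)) (at q) v,
      frechet_derivative (\<lambda>q. snd (\<Phi> q)) (at q) v))) (at q)"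
    using has_derivative_Pair[OF smooth_on_has_derivative[OF smooth_fst_\<Phi> assms(2)]
      smooth_on_has_derivative[OF smooth_snd_\<Phi> assms(2)]] by simp
  from has_derivative_compose[OF this smooth_on_has_derivative[OF g assms(3)]]
  show ?thesis
    by (subst frechet_derivativeI, assumption)
      (simp add: frechet_derivative_dx_dy[OF smooth_on_differentiable[OF g assms(3)]]
        frechet_derivative_vec_nth[OF smooth_fst_\<Phi> assms(2)]
        frechet_derivative_vec_nth[OF smooth_snd_\<Phi> assms(2)])
qed

lemma
  assumes q: "q \<in> W"
  shows dx_fst_\<Phi>: "dx h (\<lambda>q. t (fst q) $ m) q = J (fst q) $ m $ h"
    and dy_fst_\<Phi>: "dy h (\<lambda>q. t (fst q) $ m) q = 0"
    and dx_snd_\<Phi>: "dx h (\<lambda>q. snd (\<Phi> q) $ m) q = K m h q"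
    and dy_snd_\<Phi>: "dy h (\<lambda>q. snd (\<Phi> q) $ m) q = J (fst q) $ m $ h"
proof -
  note tm = smooth_on_bounded_linear[OF smooth_t bounded_linear_vec_nth open_V]
  show "dx h (\<lambda>q. t (fst q) $ m) q = J (fst q) $ m $ h"
    by (subst dx_base_function[OF tm fst_W[OF q]])
      (simp add: J_entry frechet_derivative_vec_nth[OF smooth_t fst_W[OF q]])
  show "dy h (\<lambda>q. t (fst q) $ m) q = 0"
    by (rule dy_base_function[OF tm fst_W[OF q]])
  note sm = smooth_on_fibre_coordinate[OF open_W] smooth_J_W
  have 0: "dx h (\<lambda>q. snd q $ s) q = 0" for s
    unfolding dx_def
    by (subst frechet_derivativeI[OF bounded_linear_imp_has_derivative[OF bounded_linear_fibre_coordinate]])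
      simp
  have "dx h (\<lambda>q. snd (\<Phi> q) $ m) q = dx h (\<lambda>q. \<Sum>s\<in>UNIV. snd q $ s * J (fst q) $ m $ s) q"
    by (rule dx_cong[OF open_W q snd_\<Phi>])
  also have "\<dots> = K m h q"
    by (subst dx_sum[OF smooth_on_mult[OF sm open_W] q])
      (simp add: dx_mult[OF sm q] 0 dx_base_function[OF smooth_J fst_W[OF q]] K_def B_def)
  finally show "dx h (\<lambda>q. snd (\<Phi> q) $ m) q = K m h q" .
  have "dy h (\<lambda>q. snd (\<Phi> q) $ m) q = dy h (\<lambda>q. \<Sum>s\<in>UNIV. snd q $ s * J (fst q) $ m $ s) q"
    by (rule dy_cong[OF open_W q snd_\<Phi>])
  also have "\<dots> = J (fst q) $ m $ h"
    by (subst dy_sum[OF smooth_on_mult[OF sm open_W] q])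
      (simp add: dy_mult[OF sm q] dy_fibre_coordinate dy_base_function[OF smooth_J fst_W[OF q]]
        mult_if_delta)
  finally show "dy h (\<lambda>q. snd (\<Phi> q) $ m) q = J (fst q) $ m $ h" .
qed

lemma dx_compose_\<Phi>:
  assumes "smooth_on g W'" "q \<in> W" "\<Phi> q \<in> W'"
  shows "dx h (\<lambda>q. g (\<Phi> q)) q = (\<Sum>m\<in>UNIV. J (fst q) $ m $ h * dx m g (\<Phi> q))
    + (\<Sum>m\<in>UNIV. K m h q * dy m g (\<Phi> q))"
  using frechet_derivative_compose_\<Phi>[OF assms] dx_fst_\<Phi>[OF assms(2)] dx_snd_\<Phi>[OF assms(2)]
  by (simp add: dx_def)

lemma dy_compose_\<Phi>:
  assumes "smooth_on g W'" "q \<in> W" "\<Phi> q \<in> W'"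
  shows "dy h (\<lambda>q. g (\<Phi> q)) q = (\<Sum>m\<in>UNIV. J (fst q) $ m $ h * dy m g (\<Phi> q))"
  using frechet_derivative_compose_\<Phi>[OF assms] dy_fst_\<Phi>[OF assms(2)] dy_snd_\<Phi>[OF assms(2)]
  by (simp add: dy_def)

lemma dy_base_combination:
  assumes h: "\<And>m. m \<in> I \<Longrightarrow> smooth_on (h m) V" and w: "\<And>m. m \<in> I \<Longrightarrow> smooth_on (w m) W"
    and q: "q \<in> W"
  shows "dy i (\<lambda>q. \<Sum>m\<in>I. h m (fst q) * w m q) q = (\<Sum>m\<in>I. h m (fst q) * dy i (w m) q)"
proof -
  have hW: "smooth_on (\<lambda>q. h m (fst q)) W" if "m \<in> I" for m
    by (rule smooth_on_base_function[OF h[OF that] open_W]) (use fst_W in auto)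
  show ?thesis
    by (subst dy_sum[OF smooth_on_mult[OF hW w open_W] q], assumption+)
      (simp add: dy_mult[OF hW w q] dy_base_function[OF h fst_W[OF q]])
qed

lemma dx_base_combination:
  assumes h: "\<And>m. m \<in> I \<Longrightarrow> smooth_on (h m) V" and w: "\<And>m. m \<in> I \<Longrightarrow> smooth_on (w m) W"
    and q: "q \<in> W"
  shows "dx i (\<lambda>q. \<Sum>m\<in>I. h m (fst q) * w m q) q = (\<Sum>m\<in>I. h m (fst q) * dx i (w m) q
     + frechet_derivative (h m) (at (fst q)) (axis i 1) * w m q)"
proof -
  have hW: "smooth_on (\<lambda>q. h m (fst q)) W" if "m \<in> I" for m
    by (rule smooth_on_base_function[OF h[OF that] open_W]) (use fst_W in auto)
  show ?thesis
    by (subst dx_sum[OF smooth_on_mult[OF hW w open_W] q], assumption+)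
      (simp add: dx_mult[OF hW w q] dx_base_function[OF h fst_W[OF q]])
qed

lemma smooth_B: "smooth_on (B m h s) V"
  unfolding B_def by (rule smooth_on_frechet_derivative[OF smooth_J])

lemma smooth_K: "smooth_on (K m h) W"
  unfolding K_def
  by (intro smooth_on_sum smooth_on_mult smooth_on_fibre_coordinate open_W
      smooth_on_base_function[OF smooth_B open_W]) (use fst_W in auto)

lemma dy_K:
  assumes q: "q \<in> W"
  shows "dy k (K m h) q = B m h k (fst q)"
proof -
  have "dy k (\<lambda>q. \<Sum>s\<in>UNIV. B m h s (fst q) * snd q $ s) q
      = (\<Sum>s\<in>UNIV. B m h s (fst q) * dy k (\<lambda>q. snd q $ s) q)"
    by (rule dy_base_combination[OF smooth_B smooth_on_fibre_coordinate[OF open_W] q])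
  then show ?thesis
    by (simp add: K_def[abs_def] dy_fibre_coordinate mult.commute mult_if_delta)
qed

text \<open>The vector \<open>y\<^sup>r y\<^sup>s \<partial>\<^sup>2x'\<^sup>m/\<partial>x\<^sup>r\<partial>x\<^sup>s\<close>, the inhomogeneous part of the second-order tangent map.\<close>

definition \<kappa> where "\<kappa> m q = (\<Sum>r\<in>UNIV. snd q $ r * K m r q)"

lemma smooth_\<kappa>: "smooth_on (\<kappa> m) W"
  unfolding \<kappa>_def
  by (intro smooth_on_sum smooth_on_mult smooth_on_fibre_coordinate open_W smooth_K)

lemma dy_\<kappa>:
  assumes q: "q \<in> W"
  shows "dy j (\<kappa> m) q = 2 * K m j q"
proof -
  note sm = smooth_on_fibre_coordinate[OF open_W] smooth_K
  have "dy j (\<kappa> m) q = (\<Sum>r\<in>UNIV. snd q $ r * B m r j (fst q) + (if j = r then 1 else 0) * K m r q)"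
    unfolding \<kappa>_def[abs_def]
    by (subst dy_sum[OF smooth_on_mult[OF sm open_W] q])
      (simp add: dy_mult[OF sm q] dy_fibre_coordinate dy_K[OF q])
  also have "\<dots> = (\<Sum>r\<in>UNIV. snd q $ r * B m r j (fst q)) + K m j q"
    by (simp add: sum.distrib mult_if_delta)
  also have "(\<Sum>r\<in>UNIV. snd q $ r * B m r j (fst q)) = K m j q"
    unfolding K_def using B_symmetric[OF fst_W[OF q]] by metis
  finally show ?thesis by simp
qed

end

section \<open>Transformation laws of the geometric objects\<close>

locale finsler_change = coordinate_change t V W + f: nondegenerate_function f W
    + f': nondegenerate_function f' W'
  for t :: "real ^ 'n::finite \<Rightarrow> real ^ 'n" and V W
    and f f' :: "(real ^ 'n) \<times> (real ^ 'n) \<Rightarrow> real" and W' +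
  assumes \<Phi>_W: "q \<in> W \<Longrightarrow> \<Phi> q \<in> W'"
    and f_\<Phi>: "q \<in> W \<Longrightarrow> f q = f' (\<Phi> q)"
    and invertible_J: "q \<in> W \<Longrightarrow> invertible (J (fst q))"
begin

lemma smooth_on_compose_\<Phi>: "smooth_on g W' \<Longrightarrow> smooth_on (\<lambda>q. g (\<Phi> q)) W"
  by (rule smooth_on_compose[OF _ smooth_\<Phi> open_W]) (use \<Phi>_W in auto)

lemma dy_\<Phi>: "smooth_on g W' \<Longrightarrow> q \<in> W \<Longrightarrow>
    dy h (\<lambda>q. g (\<Phi> q)) q = (\<Sum>m\<in>UNIV. J (fst q) $ m $ h * dy m g (\<Phi> q))"
  by (rule dy_compose_\<Phi>[OF _ _ \<Phi>_W])

lemma dx_\<Phi>: "smooth_on g W' \<Longrightarrow> q \<in> W \<Longrightarrow>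
    dx h (\<lambda>q. g (\<Phi> q)) q = (\<Sum>m\<in>UNIV. J (fst q) $ m $ h * dx m g (\<Phi> q))
    + (\<Sum>m\<in>UNIV. K m h q * dy m g (\<Phi> q))"
  by (rule dx_compose_\<Phi>[OF _ _ \<Phi>_W])

lemma L_\<Phi>: "q \<in> W \<Longrightarrow> f.L q = f'.L (\<Phi> q)"
  by (simp add: f.L_def f'.L_def f_\<Phi>)

lemma dy_L_change:
  assumes q: "q \<in> W"
  shows "dy h f.L q = (\<Sum>m\<in>UNIV. J (fst q) $ m $ h * dy m f'.L (\<Phi> q))"
  using dy_cong[OF open_W q L_\<Phi>] dy_\<Phi>[OF f'.smooth_L q] by simp

lemma dx_L_change:
  assumes q: "q \<in> W"
  shows "dx h f.L q = (\<Sum>m\<in>UNIV. J (fst q) $ m $ h * dx m f'.L (\<Phi> q))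
    + (\<Sum>m\<in>UNIV. K m h q * dy m f'.L (\<Phi> q))"
  using dx_cong[OF open_W q L_\<Phi>] dx_\<Phi>[OF f'.smooth_L q] by simp

lemma dy_dy_L_change:
  assumes q: "q \<in> W"
  shows "dy i (dy h f.L) q = (\<Sum>m\<in>UNIV. J (fst q) $ m $ h
    * (\<Sum>n\<in>UNIV. J (fst q) $ n $ i * dy n (dy m f'.L) (\<Phi> q)))"
proof -
  have "dy i (dy h f.L) q = dy i (\<lambda>q. \<Sum>m\<in>UNIV. J (fst q) $ m $ h * dy m f'.L (\<Phi> q)) q"
    by (rule dy_cong[OF open_W q dy_L_change])
  also have "\<dots> = (\<Sum>m\<in>UNIV. J (fst q) $ m $ h * dy i (\<lambda>q. dy m f'.L (\<Phi> q)) q)"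
    by (rule dy_base_combination[OF smooth_J smooth_on_compose_\<Phi>[OF smooth_on_dy[OF f'.smooth_L]] q])
  finally show ?thesis by (simp add: dy_\<Phi>[OF smooth_on_dy[OF f'.smooth_L] q])
qed

lemma dx_dy_L_change:
  assumes q: "q \<in> W"
  shows "dx i (dy h f.L) q = (\<Sum>m\<in>UNIV. J (fst q) $ m $ h
    * ((\<Sum>n\<in>UNIV. J (fst q) $ n $ i * dx n (dy m f'.L) (\<Phi> q))
      + (\<Sum>n\<in>UNIV. K n i q * dy n (dy m f'.L) (\<Phi> q))))
    + (\<Sum>m\<in>UNIV. B m i h (fst q) * dy m f'.L (\<Phi> q))"
proof -
  have "dx i (dy h f.L) q = dx i (\<lambda>q. \<Sum>m\<in>UNIV. J (fst q) $ m $ h * dy m f'.L (\<Phi> q)) q"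
    by (rule dx_cong[OF open_W q dy_L_change])
  also have "\<dots> = (\<Sum>m\<in>UNIV. J (fst q) $ m $ h * dx i (\<lambda>q. dy m f'.L (\<Phi> q)) q
      + B m i h (fst q) * dy m f'.L (\<Phi> q))"
    unfolding B_def
    by (rule dx_base_combination[OF smooth_J smooth_on_compose_\<Phi>[OF smooth_on_dy[OF f'.smooth_L]] q])
  finally show ?thesis by (simp add: dx_\<Phi>[OF smooth_on_dy[OF f'.smooth_L] q] sum.distrib)
qed

lemma metric_change_entry:
  assumes q: "q \<in> W"
  shows "metric f q $ i $ j = (\<Sum>n\<in>UNIV. \<Sum>m\<in>UNIV. (J (fst q) $ n $ i * J (fst q) $ m $ j)
    * metric f' (\<Phi> q) $ n $ m)"
proof -
  have "metric f q $ i $ j = (\<Sum>m\<in>UNIV. \<Sum>n\<in>UNIV. (J (fst q) $ n $ i * J (fst q) $ m $ j)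
    * metric f' (\<Phi> q) $ n $ m)"
    by (simp add: f.metric_eq f'.metric_eq dy_dy_L_change[OF q] sum_divide_distrib sum_distrib_left mult_ac)
  then show ?thesis by (subst sum.swap)
qed

lemma metric_change:
  assumes q: "q \<in> W"
  shows "metric f q = transpose (J (fst q)) ** metric f' (\<Phi> q) ** J (fst q)"
  unfolding vec_eq_iff
proof (intro allI)
  fix i j
  show "metric f q $ i $ j = (transpose (J (fst q)) ** metric f' (\<Phi> q) ** J (fst q)) $ i $ j"
    unfolding metric_change_entry[OF q]
    by (subst sum.swap)
      (simp only: matrix_matrix_mult_def transpose_def vec_lambda_beta sum_distrib_right
        sum_distrib_left mult_ac)
qed

lemma transpose_J_cancel:
  assumes q: "q \<in> W" and "transpose (J (fst q)) ** M = transpose (J (fst q)) ** N"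
  shows "M = N"
proof -
  obtain I where I: "I ** transpose (J (fst q)) = mat 1"
    using invertible_transpose[OF invertible_J[OF q]] unfolding invertible_def by blast
  have "M = (I ** transpose (J (fst q))) ** M" by (simp add: I)
  also have "\<dots> = (I ** transpose (J (fst q))) ** N"
    unfolding matrix_mul_assoc[symmetric] assms(2) ..
  finally show ?thesis by (simp add: I)
qed

text \<open>The matrix \<open>J g\<^sup>-\<^sup>1 J\<^sup>T\<close> is a right inverse of \<open>g'\<close>: after cancelling \<open>J\<^sup>T\<close> on the left this
  follows from \<open>g = J\<^sup>T g' J\<close>.\<close>

lemma metric_inv_change:
  assumes q: "q \<in> W"
  shows "metric_inv f' (\<Phi> q) = J (fst q) ** metric_inv f q ** transpose (J (fst q))"
proof -
  let ?J = "J (fst q)" and ?g' = "metric f' (\<Phi> q)" and ?h = "metric_inv f q"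
  have "transpose ?J ** (?g' ** (?J ** ?h ** transpose ?J)) = (metric f q ** ?h) ** transpose ?J"
    by (simp add: metric_change[OF q] matrix_mul_assoc)
  also have "\<dots> = transpose ?J ** mat 1" by (simp add: f.metric_inv[OF q])
  finally have "?g' ** (?J ** ?h ** transpose ?J) = mat 1" by (rule transpose_J_cancel[OF q])
  then have "metric_inv f' (\<Phi> q) ** (?g' ** (?J ** ?h ** transpose ?J)) = metric_inv f' (\<Phi> q)"
    by simp
  then show ?thesis by (simp add: matrix_mul_assoc f'.metric_inv[OF \<Phi>_W[OF q]])
qed

text \<open>Differentiating the Jacobians in \<open>\<partial>L/\<partial>y\<^sup>h\<close> along \<open>y\<close> produces the contraction of \<open>K\<close> with
  \<open>\<partial>L'/\<partial>y'\<close>, and so does \<open>\<partial>L/\<partial>x\<^sup>h\<close>; by the symmetry of second derivatives the two cancel. What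
  spoils the tensor law is the dependence of \<open>y'\<close> on \<open>x\<close> in \<open>\<partial>L'/\<partial>y'\<close>, which contributes \<open>2 g'
  \<kappa>\<close>.\<close>

lemma spray_covector_change:
  assumes q: "q \<in> W"
  shows "f.spray_covector h q = (\<Sum>m\<in>UNIV. J (fst q) $ m $ h
    * (f'.spray_covector m (\<Phi> q) + 2 * (\<Sum>n\<in>UNIV. metric f' (\<Phi> q) $ m $ n * \<kappa> n q)))"
proof -
  let ?J = "J (fst q)" and ?y = "\<lambda>r. snd q $ r"
  let ?X = "\<lambda>n m. dx n (dy m f'.L) (\<Phi> q)" and ?Y = "\<lambda>n m. dy n (dy m f'.L) (\<Phi> q)"
  let ?a = "\<lambda>m. dy m f'.L (\<Phi> q)"
  have 1: "(\<Sum>r\<in>UNIV. ?y r * dx r (dy h f.L) q)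
    = (\<Sum>m\<in>UNIV. ?J $ m $ h * (\<Sum>r\<in>UNIV. ?y r * ((\<Sum>n\<in>UNIV. ?J $ n $ r * ?X n m) + (\<Sum>n\<in>UNIV. K n r q * ?Y n m))))
    + (\<Sum>m\<in>UNIV. (\<Sum>r\<in>UNIV. ?y r * B m r h (fst q)) * ?a m)"
    unfolding dx_dy_L_change[OF q] by (rule sum_mult_add_sum_swap)
  have 2: "(\<Sum>r\<in>UNIV. ?y r * ((\<Sum>n\<in>UNIV. ?J $ n $ r * ?X n m) + (\<Sum>n\<in>UNIV. K n r q * ?Y n m)))
    = (\<Sum>n\<in>UNIV. snd (\<Phi> q) $ n * ?X n m) + (\<Sum>n\<in>UNIV. \<kappa> n q * ?Y n m)" for m
    by (simp only: distrib_left sum.distrib sum_mult_sum_swap(1) snd_\<Phi>[OF q] \<kappa>_def)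
  have 3: "(\<Sum>r\<in>UNIV. ?y r * B m r h (fst q)) = K m h q" for m
    unfolding K_def by (simp only: B_symmetric[OF fst_W[OF q], of m h])
  have 4: "(\<Sum>n\<in>UNIV. \<kappa> n q * ?Y n m) = 2 * (\<Sum>n\<in>UNIV. metric f' (\<Phi> q) $ m $ n * \<kappa> n q)" for m
    unfolding f'.metric_eq sum_distrib_left
    by (intro sum.cong refl) (simp add: dy_dy_commute[OF f'.smooth_L f'.open_S \<Phi>_W[OF q], of m])
  have "f.spray_covector h q
    = (\<Sum>m\<in>UNIV. ?J $ m $ h * ((\<Sum>n\<in>UNIV. snd (\<Phi> q) $ n * ?X n m) + (\<Sum>n\<in>UNIV. \<kappa> n q * ?Y n m)))
     - (\<Sum>m\<in>UNIV. ?J $ m $ h * dx m f'.L (\<Phi> q))"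
    unfolding f.spray_covector_def dx_L_change[OF q] 1 2 3 by simp
  also have "\<dots> = (\<Sum>m\<in>UNIV. ?J $ m $ h * (f'.spray_covector m (\<Phi> q) + (\<Sum>n\<in>UNIV. \<kappa> n q * ?Y n m)))"
    unfolding sum_subtractf[symmetric] f'.spray_covector_def by (intro sum.cong refl) argo
  finally show ?thesis unfolding 4 .
qed

text \<open>In matrix form the law for the covector reads \<open>J\<^sup>T g' J (4 G) = J\<^sup>T g' (4 G' + 2 \<kappa>)\<close>; both
  \<open>J\<^sup>T\<close> and \<open>g'\<close> are injective.\<close>

lemma spray_change:
  assumes q: "q \<in> W"
  shows "(\<Sum>i\<in>UNIV. J (fst q) $ n $ i * spray f i q) = spray f' n (\<Phi> q) + 1/2 * \<kappa> n q"
proof -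
  let ?J = "J (fst q)" and ?g = "metric f' (\<Phi> q)"
  define G where "G = (\<chi> i. spray f i q)"
  define G' where "G' = (\<chi> i. spray f' i (\<Phi> q))"
  define E' where "E' = (\<chi> i. f'.spray_covector i (\<Phi> q))"
  define k where "k = (\<chi> i. \<kappa> i q)"
  have E': "?g *v G' = (1/4) *\<^sub>R E'"
    unfolding G'_def E'_def by (rule f'.metric_spray[OF \<Phi>_W[OF q]])
  have "transpose ?J *v (?g *v (?J *v G)) = metric f q *v G"
    by (simp add: metric_change[OF q] matrix_vector_mul_assoc matrix_mul_assoc
      del: transpose_matrix_vector)
  also have "\<dots> = (1/4) *\<^sub>R (\<chi> h. f.spray_covector h q)"
    unfolding G_def by (rule f.metric_spray[OF q])
  also have "(\<chi> h. f.spray_covector h q) = transpose ?J *v (E' + 2 *\<^sub>R (?g *v k))"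
    by (simp add: vec_eq_iff spray_covector_change[OF q] matrix_vector_mult_def transpose_def
      E'_def k_def)
  also have "(1/4) *\<^sub>R (transpose ?J *v (E' + 2 *\<^sub>R (?g *v k)))
      = transpose ?J *v (?g *v (G' + (1/2) *\<^sub>R k))"
    by (simp add: E' matrix_vector_right_distrib matrix_vector_mult_scaleR scaleR_right_distrib
        del: transpose_matrix_vector)
  finally have "transpose ?J *v (?g *v (?J *v G)) = transpose ?J *v (?g *v (G' + (1/2) *\<^sub>R k))" .
  moreover have "invertible (transpose ?J)" "invertible ?g"
    using invertible_J[OF q] f'.invertible_metric[OF \<Phi>_W[OF q]] by (simp_all add: invertible_transpose)
  ultimately have "?J *v G = G' + (1/2) *\<^sub>R k"
    by (metis inj_matrix_vector_mult injD)
  from arg_cong[OF this, of "\<lambda>v. v $ n"] show ?thesis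
    by (simp add: matrix_vector_mult_def G_def G'_def k_def)
qed

text \<open>Two fibre derivatives of the law for the spray. The quadratic form \<open>\<kappa>/2\<close> in \<open>y\<close>
  contributes its polarization, the second derivatives of the coordinate change.\<close>

lemma berwald_change:
  assumes q: "q \<in> W"
  shows "(\<Sum>l\<in>UNIV. J (fst q) $ i $ l * berwald f l j k q)
    = (\<Sum>m\<in>UNIV. \<Sum>n\<in>UNIV. berwald f' i m n (\<Phi> q) * J (fst q) $ m $ j * J (fst q) $ n $ k)
      + B i j k (fst q)"
proof -
  note sp = smooth_on_compose_\<Phi>[OF smooth_on_dy[OF f'.smooth_spray]]
  have 1: "(\<Sum>l\<in>UNIV. J (fst q) $ i $ l * dy j (spray f l) q)
      = (\<Sum>a\<in>UNIV. J (fst q) $ a $ j * dy a (spray f' i) (\<Phi> q)) + K i j q" if q: "q \<in> W" for q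
  proof -
    have "(\<Sum>l\<in>UNIV. J (fst q) $ i $ l * dy j (spray f l) q)
        = dy j (\<lambda>q. \<Sum>l\<in>UNIV. J (fst q) $ i $ l * spray f l q) q"
      by (rule dy_base_combination[OF smooth_J f.smooth_spray q, symmetric])
    also have "\<dots> = dy j (\<lambda>q. spray f' i (\<Phi> q) + 1/2 * \<kappa> i q) q"
      by (rule dy_cong[OF open_W q spray_change])
    also have "\<dots> = dy j (\<lambda>q. spray f' i (\<Phi> q)) q + 1/2 * dy j (\<kappa> i) q"
      using dy_add[OF smooth_on_compose_\<Phi>[OF f'.smooth_spray]
          smooth_on_mult[OF smooth_on_const[OF open_W] smooth_\<kappa> open_W] q]
        dy_cmult[OF smooth_\<kappa> q] by metis
    finally show ?thesis by (simp add: dy_\<Phi>[OF f'.smooth_spray q] dy_\<kappa>[OF q])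
  qed
  have "(\<Sum>l\<in>UNIV. J (fst q) $ i $ l * berwald f l j k q)
      = dy k (\<lambda>q. \<Sum>l\<in>UNIV. J (fst q) $ i $ l * dy j (spray f l) q) q"
    unfolding berwald_def
    by (rule dy_base_combination[OF smooth_J smooth_on_dy[OF f.smooth_spray] q, symmetric])
  also have "\<dots> = dy k (\<lambda>q. (\<Sum>a\<in>UNIV. J (fst q) $ a $ j * dy a (spray f' i) (\<Phi> q)) + K i j q) q"
    by (rule dy_cong[OF open_W q 1])
  also have "\<dots> = dy k (\<lambda>q. \<Sum>a\<in>UNIV. J (fst q) $ a $ j * dy a (spray f' i) (\<Phi> q)) q + dy k (K i j) q"
    by (rule dy_add[OF _ smooth_K q]) (intro smooth_on_sum smooth_on_mult smooth_J_W sp open_W)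
  also have "dy k (\<lambda>q. \<Sum>a\<in>UNIV. J (fst q) $ a $ j * dy a (spray f' i) (\<Phi> q)) q
      = (\<Sum>a\<in>UNIV. J (fst q) $ a $ j * dy k (\<lambda>q. dy a (spray f' i) (\<Phi> q)) q)"
    by (rule dy_base_combination[OF smooth_J sp q])
  finally show ?thesis
    by (simp add: dy_\<Phi>[OF smooth_on_dy[OF f'.smooth_spray] q] dy_K[OF q] berwald_def
      sum_distrib_left mult_ac)
qed

lemma cartan_change:
  assumes q: "q \<in> W"
  shows "cartan f r j k q = (\<Sum>n\<in>UNIV. J (fst q) $ n $ r * (\<Sum>m\<in>UNIV. \<Sum>b\<in>UNIV.
    cartan f' n m b (\<Phi> q) * J (fst q) $ m $ j * J (fst q) $ b $ k))"
proof -
  note sm = smooth_on_compose_\<Phi>[OF f'.smooth_metric]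
  have JJ: "smooth_on (\<lambda>x. J x $ n $ r * J x $ m $ j) V" for n m
    by (intro smooth_on_mult smooth_J open_V)
  have sm': "smooth_on (\<lambda>q. \<Sum>m\<in>UNIV. (J (fst q) $ n $ r * J (fst q) $ m $ j) * metric f' (\<Phi> q) $ n $ m) W" for n
    by (intro smooth_on_sum smooth_on_mult smooth_J_W sm open_W)
  have "dy k (\<lambda>q. metric f q $ r $ j) q = dy k (\<lambda>q. \<Sum>n\<in>UNIV. \<Sum>m\<in>UNIV. (J (fst q) $ n $ r * J (fst q) $ m $ j)
      * metric f' (\<Phi> q) $ n $ m) q"
    by (rule dy_cong[OF open_W q metric_change_entry])
  also have "\<dots> = (\<Sum>n\<in>UNIV. dy k (\<lambda>q. \<Sum>m\<in>UNIV. (J (fst q) $ n $ r * J (fst q) $ m $ j)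
      * metric f' (\<Phi> q) $ n $ m) q)"
    by (rule dy_sum[OF sm' q])
  also have "\<dots> = (\<Sum>n\<in>UNIV. \<Sum>m\<in>UNIV. (J (fst q) $ n $ r * J (fst q) $ m $ j)
      * dy k (\<lambda>q. metric f' (\<Phi> q) $ n $ m) q)"
    by (simp only: dy_base_combination[OF JJ sm q])
  finally show ?thesis
    unfolding cartan_def
    by (simp add: dy_\<Phi>[OF f'.smooth_metric q] sum_distrib_left sum_divide_distrib mult_ac)
qed

text \<open>The lowered Cartan tensor is covariant by the lemma \<open>cartan_change\<close>; its first index is
  raised by \<open>J g\<^sup>-\<^sup>1 J\<^sup>T = g'\<^sup>-\<^sup>1\<close>.\<close>

lemma cartan_up_change:
  assumes q: "q \<in> W"
  shows "(\<Sum>l\<in>UNIV. J (fst q) $ i $ l * cartan_up f l j k q)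
    = (\<Sum>m\<in>UNIV. \<Sum>n\<in>UNIV. cartan_up f' i m n (\<Phi> q) * J (fst q) $ m $ j * J (fst q) $ n $ k)"
proof -
  let ?J = "J (fst q)" and ?h = "metric_inv f q" and ?h' = "metric_inv f' (\<Phi> q)"
  define T where "T = (\<chi> n. \<Sum>m\<in>UNIV. \<Sum>b\<in>UNIV. cartan f' n m b (\<Phi> q) * ?J $ m $ j * ?J $ b $ k)"
  have "(\<chi> r. cartan f r j k q) = transpose ?J *v T"
    by (simp add: vec_eq_iff cartan_change[OF q] matrix_vector_mult_def transpose_def T_def)
  moreover have "(\<chi> l. cartan_up f l j k q) = ?h *v (\<chi> r. cartan f r j k q)"
    by (simp add: vec_eq_iff cartan_up_def matrix_vector_mult_def)
  ultimately have "?J *v (\<chi> l. cartan_up f l j k q) = ?h' *v T"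
    by (simp add: metric_inv_change[OF q] matrix_vector_mul_assoc matrix_mul_assoc
      del: transpose_matrix_vector)
  from arg_cong[OF this, of "\<lambda>v. v $ i"]
  have "(\<Sum>l\<in>UNIV. ?J $ i $ l * cartan_up f l j k q)
      = (\<Sum>r\<in>UNIV. \<Sum>m\<in>UNIV. \<Sum>b\<in>UNIV. ?h' $ i $ r * cartan f' r m b (\<Phi> q) * ?J $ m $ j * ?J $ b $ k)"
    by (simp add: matrix_vector_mult_def T_def sum_distrib_left mult_ac)
  also have "\<dots> = (\<Sum>m\<in>UNIV. \<Sum>b\<in>UNIV. \<Sum>r\<in>UNIV. ?h' $ i $ r * cartan f' r m b (\<Phi> q) * ?J $ m $ j * ?J $ b $ k)"
    by (subst sum.swap, rule sum.cong[OF refl], subst sum.swap, rule refl)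
  finally show ?thesis by (simp add: cartan_up_def sum_distrib_right)
qed

end

section \<open>Charts and tangent vectors\<close>

definition overlap :: "('m, 'n::finite) chart \<Rightarrow> ('m, 'n) chart \<Rightarrow> (real ^ 'n) set" where
  "overlap c d = snd c ` (fst c \<inter> fst d)"

locale smooth_manifold =
  fixes A :: "('m::topological_space, 'n::finite) chart set"
  assumes atlas: "maximal_smooth_atlas A"
begin

abbreviation T where "T c d x \<equiv> frechet_derivative (transition c d) (at x)"

lemma
  assumes "c \<in> A"
  shows open_chart_domain: "open (fst c)"
    and open_chart_image: "open (snd c ` fst c)"
    and homeomorphism_chart: "homeomorphism (fst c) (snd c ` fst c) (snd c) (chart_inv c)"
  using atlas assms by (auto simp: maximal_smooth_atlas_def is_chart_def)

lemma chart_inv_chart: "c \<in> A \<Longrightarrow> p \<in> fst c \<Longrightarrow> chart_inv c (snd c p) = p"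
  using homeomorphism_apply1[OF homeomorphism_chart] .

lemma mem_overlap:
  "c \<in> A \<Longrightarrow> x \<in> overlap c d \<longleftrightarrow>
    x \<in> snd c ` fst c \<and> chart_inv c x \<in> fst c \<and> snd c (chart_inv c x) = x \<and> chart_inv c x \<in> fst d"
  by (auto simp: overlap_def chart_inv_chart image_iff)

lemma open_overlap:
  assumes "c \<in> A" "d \<in> A"
  shows "open (overlap c d)"
proof -
  have "openin (top_of_set (snd c ` fst c)) (overlap c d)"
    unfolding overlap_def
    by (rule homeomorphism_imp_open_map[OF homeomorphism_chart[OF assms(1)]])
      (use open_chart_domain[OF assms(2)] in \<open>simp add: openin_open_Int\<close>)
  then show ?thesis using open_chart_image[OF assms(1)] openin_open_trans by blast
qed

lemma smooth_transition:
  assumes "c \<in> A" "d \<in> A"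
  shows "smooth_on (transition c d) (overlap c d)"
  using atlas assms by (auto simp: maximal_smooth_atlas_def compatible_def overlap_def)

lemma
  assumes "c \<in> A" "d \<in> A" "x \<in> overlap c d"
  shows chart_inv_transition: "chart_inv d (transition c d x) = chart_inv c x"
    and transition_in_overlap: "transition c d x \<in> overlap d c"
    and transition_comp: "transition d e (transition c d x) = transition c e x"
  using assms by (auto simp: overlap_def transition_def chart_inv_chart)

lemma T_self:
  assumes "c \<in> A" "x \<in> snd c ` fst c"
  shows "T c c x y = y"
proof -
  have "T c c x = frechet_derivative (\<lambda>x. x) (at x)"
    by (rule frechet_derivative_cong[OF open_chart_image[OF assms(1)] assms(2)])
      (auto simp: transition_def chart_inv_chart[OF assms(1)])
  then show ?thesis by simp
qed

text \<open>The cocycle identity of the Jacobians. It makes the family of components used in the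
  definition of \<^const>\<open>tangent_vector\<close> consistent, and with \<open>e = c\<close> it shows that Jacobians
  are invertible.\<close>

lemma T_comp:
  assumes A: "c \<in> A" "d \<in> A" "e \<in> A" and x: "x \<in> overlap c d" "x \<in> overlap c e"
  shows "T d e (transition c d x) (T c d x y) = T c e x y"
proof -
  let ?O = "overlap c d \<inter> overlap c e"
  have tx: "transition c d x \<in> overlap d e"
    using transition_in_overlap[OF A(1,2) x(1)] x(2) chart_inv_transition[OF A(1,2) x(1)]
    by (simp add: mem_overlap A)
  have "((\<lambda>z. transition d e (transition c d z)) has_derivative
      (\<lambda>y. T d e (transition c d x) (T c d x y))) (at x)"
    by (rule has_derivative_compose[OF smooth_on_has_derivative smooth_on_has_derivative])
      (use smooth_transition A x tx in auto)
  moreover have "T c e x = frechet_derivative (\<lambda>z. transition d e (transition c d z)) (at x)"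
    by (rule frechet_derivative_cong[of ?O])
      (use A x in \<open>auto simp: transition_comp intro!: open_overlap\<close>)
  ultimately show ?thesis by (simp add: frechet_derivativeI)
qed

lemma linear_T: "c \<in> A \<Longrightarrow> d \<in> A \<Longrightarrow> x \<in> overlap c d \<Longrightarrow> linear (T c d x)"
  by (intro linear_frechet_derivative smooth_on_differentiable[OF smooth_transition])

text \<open>Through this lemma a function on the tangent bundle has local representatives that are
  related by the induced coordinate change.\<close>

lemma tangent_vector_change:
  assumes "c \<in> A" "d \<in> A" "x \<in> overlap c d"
  shows "tangent_vector A d (transition c d x, T c d x y) = tangent_vector A c (x, y)"
  using assms by (auto simp: tangent_vector_def chart_inv_transition fun_eq_iff mem_overlap T_comp)

lemma tangent_vector_own_component:
  assumes "c \<in> A" "x \<in> snd c ` fst c"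
  shows "snd (tangent_vector A c (x, y)) c = y"
  using assms by (auto simp: tangent_vector_def chart_inv_chart T_self)

lemma tangent_vector_in_bundle:
  assumes c: "c \<in> A" and x: "x \<in> snd c ` fst c" and U: "fst c \<subseteq> U"
  shows "tangent_vector A c (x, y) \<in> tangent_bundle A U"
proof -
  have p: "chart_inv c x \<in> fst c" "snd c (chart_inv c x) = x"
    using x by (auto simp: chart_inv_chart[OF c])
  have "T d e (snd d (chart_inv c x)) (T c d x y) = T c e x y"
    if "d \<in> A" "e \<in> A" "chart_inv c x \<in> fst d" "chart_inv c x \<in> fst e" for d e
    using T_comp[OF c that(1,2), of x y] that p x by (simp add: mem_overlap[OF c] transition_def)
  then show ?thesis using p U by (auto simp: tangent_bundle_def tangent_vector_def)
qed

lemma tangent_vector_in_slit_bundle: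
  assumes c: "c \<in> A" and q: "q \<in> slit_dom c"
  shows "tangent_vector A c q \<in> slit_tangent_bundle A (fst c)"
proof -
  obtain x y where xy: "q = (x, y)" "x \<in> snd c ` fst c" "y \<noteq> 0"
    using q by (auto simp: slit_dom_def)
  have "snd (tangent_vector A c q) \<noteq> (\<lambda>_. 0)"
    using tangent_vector_own_component[OF c xy(2), of y] xy by auto
  then show ?thesis
    using tangent_vector_in_bundle[OF c xy(2) subset_refl, of y] xy(1)
    by (auto simp: slit_tangent_bundle_def)
qed

lemma tangent_vector_scale:
  assumes "c \<in> A" "x \<in> snd c ` fst c"
  shows "tangent_vector A c (x, l *\<^sub>R y)
    = (fst (tangent_vector A c (x, y)), \<lambda>e. l *\<^sub>R snd (tangent_vector A c (x, y)) e)"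
proof -
  have "T c e x (l *\<^sub>R y) = l *\<^sub>R T c e x y" if "e \<in> A" "chart_inv c x \<in> fst e" for e
    using linear_T[of c e x] assms that
    by (intro linear_scale) (auto simp: mem_overlap chart_inv_chart)
  then show ?thesis by (simp add: tangent_vector_def fun_eq_iff)
qed

lemma slit_dom_eq: "slit_dom c = (snd c ` fst c) \<times> - {0}"
  by (auto simp: slit_dom_def)

lemma open_slit_dom: "c \<in> A \<Longrightarrow> open (slit_dom c)"
  unfolding slit_dom_eq by (intro open_Times open_chart_image open_Compl closed_singleton)

end

section \<open>Finsler metrics on a manifold\<close>

locale finsler_manifold = smooth_manifold A
  for A :: "('m::topological_space, 'n::finite) chart set" +
  fixes F :: "('m, 'n) tvec \<Rightarrow> real"
  assumes F: "finsler_metric A F"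
begin

lemma local_finsler_function:
  assumes c: "c \<in> A"
  shows "finsler_function (local_rep A c F) (slit_dom c)"
proof
  show "open (slit_dom c)" by (rule open_slit_dom[OF c])
  show "smooth_on (local_rep A c F) (slit_dom c)"
    and "q \<in> slit_dom c \<Longrightarrow> invertible (metric (local_rep A c F) q)" for q
    using F c by (auto simp: finsler_metric_def)
  have slit: "v \<in> tangent_bundle A UNIV" "snd v \<noteq> (\<lambda>_. 0)"
    if "v \<in> slit_tangent_bundle A (fst c)" for v
    using that by (auto simp: slit_tangent_bundle_def tangent_bundle_def)
  show "0 < local_rep A c F q" if q: "q \<in> slit_dom c" for q
  proof -
    note v = slit[OF tangent_vector_in_slit_bundle[OF c q]]
    have "F (tangent_vector A c q) \<ge> 0" "F (tangent_vector A c q) \<noteq> 0"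
      using F v by (auto simp: finsler_metric_def)
    then show ?thesis by (simp add: local_rep_def)
  qed
  show "local_rep A c F (x, l *\<^sub>R y) = l * local_rep A c F (x, y)"
    if q: "(x, y) \<in> slit_dom c" and l: "l > 0" for x y l
  proof -
    have x: "x \<in> snd c ` fst c" using q by (auto simp: slit_dom_def)
    obtain p \<xi> where v: "tangent_vector A c (x, y) = (p, \<xi>)" by fastforce
    have "(p, \<xi>) \<in> tangent_bundle A UNIV"
      using slit[OF tangent_vector_in_slit_bundle[OF c q]] v by simp
    then have "F (p, \<lambda>c. l *\<^sub>R \<xi> c) = l * F (p, \<xi>)"
      using F l by (auto simp: finsler_metric_def)
    then show ?thesis by (simp add: local_rep_def tangent_vector_scale[OF c x] v)
  qed
qed

lemma local_projective_factor:
  assumes c: "c \<in> A" and q: "q \<in> slit_dom c"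
  shows "local_rep A c (projective_factor A F c) q
    = (\<Sum>i\<in>UNIV. snd q $ i * dx i (local_rep A c F) q) / (2 * local_rep A c F q)"
proof -
  obtain x y where xy: "q = (x, y)" "x \<in> snd c ` fst c"
    using q by (auto simp: slit_dom_def)
  obtain p \<xi> where v: "tangent_vector A c q = (p, \<xi>)" by fastforce
  have "snd c p = x" "\<xi> c = y"
    using v tangent_vector_own_component[OF c xy(2), of y] xy(2)
    by (auto simp: xy(1) tangent_vector_def chart_inv_chart[OF c])
  moreover have "local_rep A c (projective_factor A F c) q = projective_factor A F c (p, \<xi>)"
    by (simp add: local_rep_def v)
  ultimately show ?thesis by (simp add: projective_factor_def Let_def xy(1))
qed

text \<open>The factor \<open>P\<close> is only required to agree with the one computed in the chart \<open>c\<close>, so that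
  the lemma also covers charts other than the one in which \<open>P\<close> was defined.\<close>

lemma local_projectively_flat_function:
  assumes c: "c \<in> A" and flat: "projectively_flat A F c"
    and P: "\<And>v. v \<in> slit_tangent_bundle A (fst c) \<Longrightarrow> projective_factor A F c v = P v"
  shows "projectively_flat_function (local_rep A c F) (slit_dom c) (local_rep A c P)"
proof -
  interpret finsler_function "local_rep A c F" "slit_dom c"
    by (rule local_finsler_function[OF c])
  show ?thesis
  proof
    fix q i assume q: "q \<in> slit_dom c"
    show "(\<Sum>k\<in>UNIV. snd q $ k * dy i (dx k (local_rep A c F)) q) = dx i (local_rep A c F) q"
      using flat q by (simp add: projectively_flat_def Let_def)
    have "local_rep A c P q = local_rep A c (projective_factor A F c) q"
      using P[OF tangent_vector_in_slit_bundle[OF c q]] by (simp add: local_rep_def)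
    then show "local_rep A c P q
      = (\<Sum>i\<in>UNIV. snd q $ i * dx i (local_rep A c F) q) / (2 * local_rep A c F q)"
      by (simp add: local_projective_factor[OF c q])
  qed
qed

definition slit_overlap where "slit_overlap c d = overlap c d \<times> - {0 :: real ^ 'n}"

lemma slit_overlap_subset: "slit_overlap c d \<subseteq> slit_dom c"
  by (auto simp: slit_overlap_def overlap_def slit_dom_eq)

lemma coordinate_change_transition:
  assumes "c \<in> A" "d \<in> A"
  shows "coordinate_change (transition c d) (overlap c d) (slit_overlap c d)"
  using open_overlap[OF assms] smooth_transition[OF assms]
  by unfold_locales (auto simp: slit_overlap_def intro!: open_Times)

lemma finsler_change_transition:
  assumes c: "c \<in> A" and d: "d \<in> A"
  shows "finsler_change (transition c d) (overlap c d) (slit_overlap c d)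
    (local_rep A c F) (local_rep A d F) (slit_dom d)"
proof -
  interpret coordinate_change "transition c d" "overlap c d" "slit_overlap c d"
    by (rule coordinate_change_transition[OF c d])
  interpret c: finsler_function "local_rep A c F" "slit_dom c"
    by (rule local_finsler_function[OF c])
  interpret d: finsler_function "local_rep A d F" "slit_dom d"
    by (rule local_finsler_function[OF d])
  have inverse_T: "T d c (transition c d x) (T c d x y) = y" if "x \<in> overlap c d" for x y
    using T_comp[OF c d c that, of y] T_self[OF c, of x y] that
    by (auto simp: overlap_def)
  show ?thesis
  proof
    fix q assume q: "q \<in> slit_overlap c d"
    then have x: "fst q \<in> overlap c d" and y: "snd q \<noteq> 0" by (auto simp: slit_overlap_def)
    show "invertible (metric (local_rep A c F) q)"
      using c.invertible_metric q slit_overlap_subset by blast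
    have "linear (T d c (transition c d (fst q)))"
      by (rule linear_T[OF d c transition_in_overlap[OF c d x]])
    then have "matrix (T d c (transition c d (fst q))) *v (J (fst q) *v y) = y" for y
      by (simp add: matrix_works linear_matrix_vector_mul_eq J_mult[OF x] inverse_T[OF x])
    then have "matrix (T d c (transition c d (fst q))) ** J (fst q) = mat 1"
      by (simp add: matrix_eq matrix_vector_mul_assoc[symmetric])
    then show "invertible (J (fst q))" by (auto simp: invertible_left_inverse)
    have "T c d (fst q) (snd q) \<noteq> 0"
      using inverse_T[OF x, of "snd q"] y linear_0[OF linear_T[OF d c transition_in_overlap[OF c d x]]]
      by auto
    then show "\<Phi> q \<in> slit_dom d"
      using transition_in_overlap[OF c d x] by (auto simp: \<Phi>_def slit_dom_eq overlap_def)
    show "local_rep A c F q = local_rep A d F (\<Phi> q)"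
      using tangent_vector_change[OF c d x, of "snd q"] by (simp add: local_rep_def \<Phi>_def)
  next
    show "smooth_on (local_rep A c F) (slit_overlap c d)"
      by (rule smooth_on_subset[OF c.smooth_f slit_overlap_subset])
  qed (rule open_W)
qed

text \<open>The inhomogeneous term of the connection law comes from the Berwald part alone; the
  remaining part is a tensor.\<close>

theorem berwald_plus_cartan_linear_connection:
  fixes Q :: "('m, 'n) tvec \<Rightarrow> real"
  assumes smooth_Q: "\<And>d. d \<in> A \<Longrightarrow> fst d \<subseteq> U \<Longrightarrow> smooth_on (local_rep A d Q) (slit_dom d)"
  shows "linear_connection_on A U (\<lambda>d i j k q. berwald (local_rep A d F) i j k q
    + local_rep A d Q q * cartan_up (local_rep A d F) i j k q)"
  unfolding linear_connection_on_def
proof (intro conjI ballI impI allI, goal_cases)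
  case (1 c i j k)
  interpret finsler_function "local_rep A c F" "slit_dom c"
    by (rule local_finsler_function[OF 1(1)])
  show ?case
    using smooth_Q[OF 1] by (intro smooth_on_add smooth_on_mult smooth_berwald smooth_cartan_up open_S)
next
  case (2 c d x y i j k)
  then have c: "c \<in> A" and d: "d \<in> A" by auto
  interpret finsler_change "transition c d" "overlap c d" "slit_overlap c d"
    "local_rep A c F" "local_rep A d F" "slit_dom d"
    by (rule finsler_change_transition[OF c d])
  have x: "x \<in> overlap c d" using 2 by (simp add: overlap_def)
  have q: "(x, y) \<in> slit_overlap c d" using 2 x by (simp add: slit_overlap_def)
  have Q: "local_rep A c Q (x, y) = local_rep A d Q (\<Phi> (x, y))"
    using tangent_vector_change[OF c d x, of y] by (simp add: local_rep_def \<Phi>_def)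
  have "(\<Sum>l\<in>UNIV. J x $ i $ l * (berwald (local_rep A c F) l j k (x, y)
      + local_rep A c Q (x, y) * cartan_up (local_rep A c F) l j k (x, y)))
    = (\<Sum>l\<in>UNIV. J x $ i $ l * berwald (local_rep A c F) l j k (x, y))
      + local_rep A c Q (x, y) * (\<Sum>l\<in>UNIV. J x $ i $ l * cartan_up (local_rep A c F) l j k (x, y))"
    by (simp add: distrib_left sum.distrib sum_distrib_left mult_ac)
  also have "\<dots> = (\<Sum>m\<in>UNIV. \<Sum>n\<in>UNIV. (berwald (local_rep A d F) i m n (\<Phi> (x, y))
      + local_rep A d Q (\<Phi> (x, y)) * cartan_up (local_rep A d F) i m n (\<Phi> (x, y)))
        * J x $ m $ j * J x $ n $ k) + B i j k x"
    using berwald_change[OF q, of i j k] cartan_up_change[OF q, of i j k]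
    by (simp add: Q distrib_left distrib_right sum.distrib sum_distrib_left mult_ac)
  finally show ?case by (simp add: Let_def J_entry B_def \<Phi>_def)
qed

end

theorem corollary4p5:
  fixes A :: "('m::{t2_space, second_countable_topology}, 'n::finite) chart set"
    and F P :: "('m, 'n) tvec \<Rightarrow> real"
    and c :: "('m, 'n) chart"
  assumes "maximal_smooth_atlas A"
    and "finsler_metric A F"
    and "c \<in> A"
    and "projectively_flat A F c"
    and "P = projective_factor A F c"
  shows
    "(let f = local_rep A c F; P' = local_rep A c P in
      \<forall>q \<in> slit_dom c. \<forall>i j k.
        spray f i q = P' q * snd q $ i \<and>
        H_low f i q = P' q * y_low f i q \<and>
        H_coeff f i j k q = berwald f i j k q + 2 * P' q * cartan_up f i j k q \<and>
        berwald f i j k q = dy k (dy j P') q * snd q $ i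
          + dy j P' q * (if i = k then 1 else 0) + dy k P' q * (if i = j then 1 else 0))
    \<and> (\<exists>\<Gamma>. linear_connection_on A (fst c) \<Gamma>
        \<and> (\<forall>q \<in> slit_dom c. \<forall>i j k. \<Gamma> c i j k q = H_coeff (local_rep A c F) i j k q)
        \<and> (\<forall>d\<in>A. fst d \<subseteq> fst c \<longrightarrow> (\<forall>q \<in> slit_dom d. \<forall>i j k.
             \<Gamma> d i j k q = berwald (local_rep A d F) i j k q
               + 2 * local_rep A d P q * cartan_up (local_rep A d F) i j k q))
        \<and> (\<forall>d\<in>A. fst d \<subseteq> fst c \<and> projectively_flat A F d \<and>
             (\<forall>v \<in> slit_tangent_bundle A (fst d). projective_factor A F d v = P v) \<longrightarrow>
             (\<forall>q \<in> slit_dom d. \<forall>i j k. \<Gamma> d i j k q = H_coeff (local_rep A d F) i j k q)))"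
proof -
  interpret finsler_manifold A F
    by unfold_locales (rule assms)+
  interpret c: projectively_flat_function "local_rep A c F" "slit_dom c" "local_rep A c P"
    by (rule local_projectively_flat_function) (use assms in auto)
  \<comment> \<open>the factor 2 sits inside the scalar function, so that the theorem on connections applies with \<open>Q = 2 P\<close>\<close>
  define \<Gamma> where "\<Gamma> = (\<lambda>d i j k q. berwald (local_rep A d F) i j k q
    + local_rep A d (\<lambda>v. 2 * P v) q * cartan_up (local_rep A d F) i j k q)"
  have smooth_P: "smooth_on (local_rep A d (\<lambda>v. 2 * P v)) (slit_dom d)"
    if d: "d \<in> A" and sub: "fst d \<subseteq> fst c" for d
  proof -
    interpret dc: finsler_change "transition d c" "overlap d c" "slit_overlap d c"
      "local_rep A d F" "local_rep A c F" "slit_dom c"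
      by (rule finsler_change_transition[OF d assms(3)])
    \<comment> \<open>charts inside the domain of \<open>c\<close> lie entirely in the overlap, so the smoothness of \<open>P\<close> carries over to them\<close>
    have dom: "slit_overlap d c = slit_dom d"
      using sub by (auto simp: slit_overlap_def slit_dom_eq overlap_def Int_absorb2)
    have "smooth_on (\<lambda>q. 2 * local_rep A c P (dc.\<Phi> q)) (slit_dom d)"
      using dc.smooth_on_compose_\<Phi>[OF c.smooth_P] unfolding dom
      by (intro smooth_on_mult smooth_on_const open_slit_dom d)
    moreover have "2 * local_rep A c P (dc.\<Phi> q) = local_rep A d (\<lambda>v. 2 * P v) q"
      if "q \<in> slit_dom d" for q
      using tangent_vector_change[OF d assms(3), of "fst q" "snd q"] dc.fst_W[of q] that
      by (simp add: local_rep_def dc.\<Phi>_def dom)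
    ultimately show ?thesis by (rule smooth_on_cong[OF _ open_slit_dom[OF d]])
  qed
  have eq: "\<Gamma> d i j k q = berwald (local_rep A d F) i j k q
      + 2 * local_rep A d P q * cartan_up (local_rep A d F) i j k q" for d i j k q
    by (simp add: \<Gamma>_def local_rep_def)
  have H: "\<Gamma> d i j k q = H_coeff (local_rep A d F) i j k q"
    if "d \<in> A" "projectively_flat A F d" "q \<in> slit_dom d"
      "\<And>v. v \<in> slit_tangent_bundle A (fst d) \<Longrightarrow> projective_factor A F d v = P v" for d i j k q
    using projectively_flat_function.H_coeff_flat[OF local_projectively_flat_function[OF that(1,2,4)] that(3)]
    by (simp add: eq)
  have "linear_connection_on A (fst c) \<Gamma>"
    unfolding \<Gamma>_def by (rule berwald_plus_cartan_linear_connection[OF smooth_P])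
  moreover have "\<forall>q \<in> slit_dom c. \<forall>i j k. \<Gamma> c i j k q = H_coeff (local_rep A c F) i j k q"
    using H assms by simp
  moreover have "\<forall>d\<in>A. fst d \<subseteq> fst c \<and> projectively_flat A F d \<and>
      (\<forall>v \<in> slit_tangent_bundle A (fst d). projective_factor A F d v = P v) \<longrightarrow>
      (\<forall>q \<in> slit_dom d. \<forall>i j k. \<Gamma> d i j k q = H_coeff (local_rep A d F) i j k q)"
    using H by simp
  ultimately show ?thesis
    unfolding Let_def using c.spray_flat c.H_low_flat c.H_coeff_flat c.berwald_flat eq
    by (intro conjI exI[of _ \<Gamma>]) simp_all
qed

end
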